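(* For every $d\ge2$, the number of similarity classes of $d$-dimensional perfect lattices is at most $$I_d^{\,d+1}\binom{3^dI_d}{\binom d2}.$$
   Context: A $d$-dimensional Euclidean lattice $\Lambda$ is perfect if $\{v\otimes v\}$, $v$ ranging over its minimal vectors (nonzero vectors of minimal length), spans the $\binom{d+1}{2}$-dimensional space of symmetric tensors in $(\Lambda\otimes\mathbb R)^{\otimes2}$. A lattice is well-rounded if its minimal vectors span $\Lambda\otimes\mathbb R$. $I_d$ is the smallest integer such that whenever $\Lambda$ is a $d$-dimensional lattice and $\Lambda'\subseteq\Lambda$ is a $d$-dimensional well-rounded sublattice whose minimal vectors are all minimal vectors of $\Lambda$, the index $[\Lambda:\Lambda']$ is at most $I_d$. *)

theory Defs
  imports "HOL-Analysis.Analysis"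
begin

text \<open>Full-rank lattices in real^'n (dimension d = CARD('n)):
  the integer span of the columns of an invertible matrix.\<close>
definition is_lattice :: "(real^'n::finite) set \<Rightarrow> bool" where
  "is_lattice L \<longleftrightarrow> (\<exists>B::real^'n^'n. invertible B \<and>
      L = (\<lambda>z::int^'n. B *v (\<chi> i. real_of_int (z $ i))) ` UNIV)"

text \<open>Minimal vectors: nonzero vectors of minimal length.\<close>
definition min_vecs :: "(real^'n::finite) set \<Rightarrow> (real^'n) set" where
  "min_vecs L = {v \<in> L. v \<noteq> 0 \<and> (\<forall>w\<in>L. w \<noteq> 0 \<longrightarrow> norm v \<le> norm w)}"

text \<open>The symmetric tensor v \<otimes> v, as the matrix (v_i v_j).\<close>
definition outer_sq :: "real^'n::finite \<Rightarrow> real^'n^'n" where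
  "outer_sq v = (\<chi> i j. v $ i * v $ j)"

definition perfect :: "(real^'n::finite) set \<Rightarrow> bool" where
  "perfect L \<longleftrightarrow> span (outer_sq ` min_vecs L) = {M. transpose M = M}"

definition well_rounded :: "(real^'n::finite) set \<Rightarrow> bool" where
  "well_rounded L \<longleftrightarrow> span (min_vecs L) = UNIV"

text \<open>Index [L : L'] = number of cosets of L' in L.\<close>
definition lat_index :: "(real^'n::finite) set \<Rightarrow> (real^'n) set \<Rightarrow> nat" where
  "lat_index L L' = card ((\<lambda>v. {w \<in> L. w - v \<in> L'}) ` L)"

text \<open>The constant I_d for d = CARD('n).\<close>
definition I_const :: "'n::finite itself \<Rightarrow> nat" where
  "I_const _ = (LEAST k. \<forall>(L::(real^'n) set) L'. is_lattice L \<and> is_lattice L' \<and> L' \<subseteq> L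
      \<and> well_rounded L' \<and> min_vecs L' \<subseteq> min_vecs L \<longrightarrow> lat_index L L' \<le> k)"

text \<open>Similarity: a positive scaling composed with an orthogonal transformation.\<close>
definition similar_lat :: "(real^'n::finite) set \<Rightarrow> (real^'n) set \<Rightarrow> bool" where
  "similar_lat L1 L2 \<longleftrightarrow> (\<exists>c f. c > 0 \<and> orthogonal_transformation f \<and>
      L2 = (\<lambda>v. c *\<^sub>R f v) ` L1)"

definition similarity_rel :: "((real^'n::finite) set \<times> (real^'n) set) set" where
  "similarity_rel = {(L1, L2). similar_lat L1 L2}"

end

theory Submission
  imports Defs
begin

text \<open>
  A perfect lattice \<open>L\<close> is determined up to similarity by finitely many discrete data.
  Take a basis \<open>f\<close> of minimal vectors of maximal determinant; by Cramer's rule every minimal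
  vector has coordinates in \<open>[-1, 1]\<close> with respect to it. The lattice spanned by \<open>f\<close> is well
  rounded and shares its minimal vectors with \<open>L\<close>, so its index in \<open>L\<close> is at most \<open>I\<^sub>d\<close>.
  In the coordinates of \<open>f\<close>, \<open>L\<close> becomes an overlattice of \<open>\<int>\<^sup>d\<close> of index at most \<open>I\<^sub>d\<close>, which is
  described by a Hermite normal form; there are at most \<open>I\<^sub>d\<^sup>d\<close> of these. Perfection supplies
  \<open>d choose 2\<close> further minimal vectors whose squares \<open>v \<otimes> v\<close>, together with those of \<open>f\<close>, span
  the symmetric matrices; their coordinates are among the at most \<open>3\<^sup>d I\<^sub>d\<close> points of the
  overlattice in the cube \<open>[-1, 1]\<^sup>d\<close>. Two lattices with the same data differ by a linear map
  \<open>T\<close> sending all these minimal vectors to vectors of one common length; then \<open>T\<^sup>T T\<close> is a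
  multiple of the identity, so \<open>T\<close> is a similarity.
\<close>

section \<open>Additive subgroups and lattices\<close>

definition add_subgroup :: "'a::ab_group_add set \<Rightarrow> bool" where
  "add_subgroup M \<longleftrightarrow> 0 \<in> M \<and> (\<forall>x\<in>M. \<forall>y\<in>M. x - y \<in> M)"

lemma add_subgroup_0: "add_subgroup M \<Longrightarrow> 0 \<in> M"
  by (simp add: add_subgroup_def)

lemma add_subgroup_diff: "add_subgroup M \<Longrightarrow> x \<in> M \<Longrightarrow> y \<in> M \<Longrightarrow> x - y \<in> M"
  by (simp add: add_subgroup_def)

lemma add_subgroup_minus: "add_subgroup M \<Longrightarrow> x \<in> M \<Longrightarrow> - x \<in> M"
  using add_subgroup_diff[of M 0 x] by (simp add: add_subgroup_0)

lemma add_subgroup_add: "add_subgroup M \<Longrightarrow> x \<in> M \<Longrightarrow> y \<in> M \<Longrightarrow> x + y \<in> M"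
  using add_subgroup_diff[of M x "- y"] by (simp add: add_subgroup_minus)

lemma add_subgroup_sum:
  "add_subgroup M \<Longrightarrow> (\<And>j. j \<in> A \<Longrightarrow> f j \<in> M) \<Longrightarrow> sum f A \<in> M"
  by (induction A rule: infinite_finite_induct) (auto intro: add_subgroup_0 add_subgroup_add)

lemma add_subgroup_of_int_scaleR:
  fixes x :: "'a::real_vector"
  assumes M: "add_subgroup M" and x: "x \<in> M"
  shows "of_int n *\<^sub>R x \<in> M"
proof -
  have nat: "of_nat m *\<^sub>R x \<in> M" for m
    by (induction m) (auto simp: algebra_simps add_subgroup_0[OF M] intro: add_subgroup_add[OF M x])
  show ?thesis
  proof (cases "n \<ge> 0")
    case True
    then show ?thesis using nat[of "nat n"] by simp
  next
    case False
    then show ?thesis using add_subgroup_minus[OF M nat[of "nat (- n)"]] by simp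
  qed
qed

lemma add_subgroup_vimage_linear:
  "add_subgroup M \<Longrightarrow> linear f \<Longrightarrow> add_subgroup (f -` M)"
  by (simp add: add_subgroup_def linear_0 linear_diff)

lemma add_subgroup_Int: "add_subgroup A \<Longrightarrow> add_subgroup B \<Longrightarrow> add_subgroup (A \<inter> B)"
  by (simp add: add_subgroup_def)

lemma add_subgroup_image_linear:
  assumes M: "add_subgroup M" and f: "linear f"
  shows "add_subgroup (f ` M)"
  unfolding add_subgroup_def
proof (intro conjI ballI)
  show "0 \<in> f ` M" using add_subgroup_0[OF M] linear_0[OF f] by (metis image_eqI)
  fix u v assume "u \<in> f ` M" "v \<in> f ` M"
  then obtain x y where "x \<in> M" "y \<in> M" "u = f x" "v = f y" by blast
  then show "u - v \<in> f ` M" using add_subgroup_diff[OF M] linear_diff[OF f] by (metis image_eqI)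
qed

definition int_vec :: "real^'n::finite \<Rightarrow> bool" where
  "int_vec x \<longleftrightarrow> (\<forall>i. x $ i \<in> \<int>)"

lemma add_subgroup_int_vec: "add_subgroup (Collect int_vec)"
  by (simp add: add_subgroup_def int_vec_def)

lemma int_vec_axis: "int_vec (axis i 1)"
  by (simp add: int_vec_def axis_def)

lemma matrix_inv:
  assumes "invertible (A::real^'n::finite^'n)"
  shows matrix_inv_left: "matrix_inv A ** A = mat 1"
    and matrix_inv_right: "A ** matrix_inv A = mat 1"
proof -
  from assms obtain A' where "A ** A' = mat 1 \<and> A' ** A = mat 1"
    unfolding invertible_def by blast
  then have "A ** matrix_inv A = mat 1 \<and> matrix_inv A ** A = mat 1"
    unfolding matrix_inv_def by (rule someI)
  then show "matrix_inv A ** A = mat 1" "A ** matrix_inv A = mat 1" by auto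
qed

lemma matrix_inv_vector_left: "invertible (A::real^'n::finite^'n) \<Longrightarrow> matrix_inv A *v (A *v x) = x"
  by (simp add: matrix_vector_mul_assoc matrix_inv_left)

lemma matrix_inv_vector_right: "invertible (A::real^'n::finite^'n) \<Longrightarrow> A *v (matrix_inv A *v x) = x"
  by (simp add: matrix_vector_mul_assoc matrix_inv_right)

lemma inj_matrix_inv_vector: "invertible (A::real^'n::finite^'n) \<Longrightarrow> inj ((*v) (matrix_inv A))"
  by (metis injI matrix_inv_vector_right)

definition lattice_of :: "real^'n^'n \<Rightarrow> (real^'n::finite) set" where
  "lattice_of B = {x. int_vec (matrix_inv B *v x)}"

lemma mult_in_lattice_of_iff: "invertible B \<Longrightarrow> B *v c \<in> lattice_of B \<longleftrightarrow> int_vec c"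
  by (simp add: lattice_of_def matrix_inv_vector_left)

lemma add_subgroup_lattice_of: "add_subgroup (lattice_of B)"
proof -
  have "lattice_of B = (*v) (matrix_inv B) -` Collect int_vec"
    by (auto simp: lattice_of_def)
  then show ?thesis
    using add_subgroup_vimage_linear[OF add_subgroup_int_vec matrix_vector_mul_linear] by simp
qed

lemma is_lattice_iff: "is_lattice L \<longleftrightarrow> (\<exists>B. invertible B \<and> L = lattice_of B)"
proof -
  have "range (\<lambda>z::int^'n. B *v (\<chi> i. real_of_int (z $ i))) = lattice_of B"
    if B: "invertible B" for B :: "real^'n::finite^'n"
  proof (intro set_eqI iffI)
    fix x assume "x \<in> range (\<lambda>z::int^'n. B *v (\<chi> i. real_of_int (z $ i)))"
    then show "x \<in> lattice_of B" using B by (auto simp: mult_in_lattice_of_iff int_vec_def)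
  next
    fix x assume "x \<in> lattice_of B"
    then have "\<forall>i. (matrix_inv B *v x) $ i \<in> \<int>" by (simp add: lattice_of_def int_vec_def)
    then have "(\<chi> i. real_of_int \<lfloor>(matrix_inv B *v x) $ i\<rfloor>) = matrix_inv B *v x"
      by (simp add: vec_eq_iff)
    then have "B *v (\<chi> i. real_of_int ((\<chi> i. \<lfloor>(matrix_inv B *v x) $ i\<rfloor>) $ i)) = x"
      using B by (simp add: matrix_inv_vector_right)
    then show "x \<in> range (\<lambda>z::int^'n. B *v (\<chi> i. real_of_int (z $ i)))" by (metis rangeI)
  qed
  then show ?thesis unfolding is_lattice_def by metis
qed

definition column_matrix :: "('n \<Rightarrow> real^'n) \<Rightarrow> real^'n^'n::finite" where
  "column_matrix f = (\<chi> r c. f c $ r)"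

lemma column_matrix_mult: "column_matrix f *v x = (\<Sum>c\<in>UNIV. x $ c *\<^sub>R f c)"
  by (simp add: vec_eq_iff column_matrix_def matrix_vector_mult_def sum_component mult.commute)

lemma column_matrix_axis: "column_matrix f *v axis i 1 = f i"
proof -
  have "(\<lambda>c. axis i 1 $ c *\<^sub>R f c) = (\<lambda>c. if c = i then f c else 0)"
    by (auto simp: axis_def)
  then show ?thesis by (simp only: column_matrix_mult) simp
qed

lemma matrix_inv_column_matrix_apply:
  "invertible (column_matrix f) \<Longrightarrow> matrix_inv (column_matrix f) *v f i = axis i 1"
  by (metis column_matrix_axis matrix_inv_vector_left)

lemma lattice_of_column_matrix_subset:
  assumes inv: "invertible (column_matrix g)" and M: "add_subgroup M" and g: "\<And>i. g i \<in> M"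
  shows "lattice_of (column_matrix g) \<subseteq> M"
proof
  fix x assume "x \<in> lattice_of (column_matrix g)"
  then have c: "int_vec (matrix_inv (column_matrix g) *v x)" by (simp add: lattice_of_def)
  have "x = (\<Sum>i\<in>UNIV. (matrix_inv (column_matrix g) *v x) $ i *\<^sub>R g i)"
    using inv by (simp add: matrix_inv_vector_right flip: column_matrix_mult)
  also have "\<dots> \<in> M"
  proof (intro add_subgroup_sum[OF M])
    fix i
    from c obtain m where "(matrix_inv (column_matrix g) *v x) $ i = of_int m"
      by (auto simp: int_vec_def elim: Ints_cases)
    then show "(matrix_inv (column_matrix g) *v x) $ i *\<^sub>R g i \<in> M"
      using add_subgroup_of_int_scaleR[OF M g] by simp
  qed
  finally show "x \<in> M" .
qed

lemma finite_lattice_ball: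
  assumes "invertible (B::real^'n::finite^'n)"
  shows "finite {x \<in> lattice_of B. norm x \<le> r}"
proof -
  obtain K where K: "\<And>x. norm (matrix_inv B *v x) \<le> norm x * K"
    using bounded_linear.bounded[OF matrix_vector_mul_bounded_linear] by blast
  define R where "R = \<lceil>\<bar>r * K\<bar>\<rceil>"
  define C :: "('n \<Rightarrow> real) set" where "C = Pi\<^sub>E UNIV (\<lambda>_. real_of_int ` {-R..R})"
  have "{x \<in> lattice_of B. norm x \<le> r} \<subseteq> (\<lambda>c. B *v vec_lambda c) ` C"
  proof
    fix x assume x: "x \<in> {x \<in> lattice_of B. norm x \<le> r}"
    define c where "c = matrix_inv B *v x"
    have "c $ i \<in> real_of_int ` {-R..R}" for i
    proof -
      from x obtain m where m: "c $ i = of_int m"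
        by (auto simp: c_def lattice_of_def int_vec_def elim: Ints_cases)
      have "\<bar>c $ i\<bar> \<le> norm x * K" using K component_le_norm_cart order_trans c_def by metis
      also have "\<dots> \<le> norm x * \<bar>K\<bar>" by (simp add: mult_left_mono)
      also have "\<dots> \<le> \<bar>r\<bar> * \<bar>K\<bar>" using x by (intro mult_right_mono) auto
      also have "\<dots> = \<bar>r * K\<bar>" by (simp add: abs_mult)
      finally have "\<bar>m\<bar> \<le> R" unfolding R_def m by linarith
      then have "m \<in> {-R..R}" by auto
      then show ?thesis using m by simp
    qed
    then have "vec_nth c \<in> C" by (simp add: C_def PiE_UNIV_domain)
    moreover have "x = B *v vec_lambda (vec_nth c)"
      using assms by (simp add: c_def matrix_inv_vector_right)
    ultimately show "x \<in> (\<lambda>c. B *v vec_lambda c) ` C" by blast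
  qed
  moreover have "finite C" by (simp add: C_def finite_PiE)
  ultimately show ?thesis by (meson finite_imageI finite_subset)
qed

lemma min_vecs_norm_eq: "v \<in> min_vecs L \<Longrightarrow> w \<in> min_vecs L \<Longrightarrow> norm v = norm w"
  unfolding min_vecs_def by (auto intro: antisym)

lemma min_vecs_le: "v \<in> min_vecs L \<Longrightarrow> w \<in> L \<Longrightarrow> w \<noteq> 0 \<Longrightarrow> norm v \<le> norm w"
  unfolding min_vecs_def by auto

lemma finite_min_vecs_lattice_of:
  assumes "invertible B"
  shows "finite (min_vecs (lattice_of B))"
proof (cases "min_vecs (lattice_of B) = {}")
  case False
  then obtain v where v: "v \<in> min_vecs (lattice_of B)" by blast
  have "min_vecs (lattice_of B) \<subseteq> {x \<in> lattice_of B. norm x \<le> norm v}"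
    using v min_vecs_norm_eq unfolding min_vecs_def by fastforce
  then show ?thesis using finite_lattice_ball[OF assms] finite_subset by blast
qed simp

section \<open>The index bound\<close>

definition vec_floor :: "real^'n::finite \<Rightarrow> real^'n" where
  "vec_floor x = (\<chi> i. of_int \<lfloor>x $ i\<rfloor>)"

definition vec_frac :: "real^'n::finite \<Rightarrow> real^'n" where
  "vec_frac x = x - vec_floor x"

lemma vec_frac_eq_iff: "vec_frac x = vec_frac y \<longleftrightarrow> int_vec (x - y)"
proof
  assume "vec_frac x = vec_frac y"
  then have "x - y = vec_floor x - vec_floor y" unfolding vec_frac_def by (simp add: algebra_simps)
  then show "int_vec (x - y)" by (simp add: int_vec_def vec_floor_def)
next
  assume h: "int_vec (x - y)"
  show "vec_frac x = vec_frac y"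
  proof (unfold vec_eq_iff, rule allI)
    fix i
    from h have "x $ i - y $ i \<in> \<int>" by (simp add: int_vec_def)
    then obtain m where m: "x $ i = y $ i + of_int m"
      by (metis Ints_cases add.commute diff_add_cancel)
    have "\<lfloor>x $ i\<rfloor> = \<lfloor>y $ i\<rfloor> + m" by (simp add: m)
    then show "vec_frac x $ i = vec_frac y $ i" by (simp add: vec_frac_def vec_floor_def m)
  qed
qed

lemma vec_frac_bounds: "0 \<le> vec_frac x $ i" "vec_frac x $ i < 1"
  by (simp_all add: vec_frac_def vec_floor_def) linarith+

lemma int_vec_diff_vec_frac: "int_vec (x - vec_frac x)"
  by (simp add: vec_frac_def int_vec_def vec_floor_def)

lemma coset_eq_iff:
  assumes "add_subgroup L'" "L' \<subseteq> L" "x \<in> L" "y \<in> L"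
  shows "{w \<in> L. w - x \<in> L'} = {w \<in> L. w - y \<in> L'} \<longleftrightarrow> x - y \<in> L'"
proof
  assume "{w \<in> L. w - x \<in> L'} = {w \<in> L. w - y \<in> L'}"
  moreover have "x \<in> {w \<in> L. w - x \<in> L'}" using assms by (simp add: add_subgroup_0)
  ultimately show "x - y \<in> L'" by blast
next
  assume xy: "x - y \<in> L'"
  have "w - x \<in> L' \<longleftrightarrow> w - y \<in> L'" for w
  proof
    assume "w - x \<in> L'"
    from add_subgroup_add[OF assms(1) this xy] show "w - y \<in> L'" by simp
  next
    assume "w - y \<in> L'"
    from add_subgroup_diff[OF assms(1) this xy] show "w - x \<in> L'" by simp
  qed
  then show "{w \<in> L. w - x \<in> L'} = {w \<in> L. w - y \<in> L'}" by blast
qed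

lemma card_image_le_if_factors:
  assumes "\<And>x y. x \<in> A \<Longrightarrow> y \<in> A \<Longrightarrow> f x = f y \<Longrightarrow> g x = g y" and "finite (f ` A)"
  shows "finite (g ` A) \<and> card (g ` A) \<le> card (f ` A)"
proof -
  have "g x = g (inv_into A f (f x))" if "x \<in> A" for x
    by (rule assms(1)) (use that in \<open>auto simp: inv_into_into f_inv_into_f\<close>)
  then have "g ` A = (\<lambda>u. g (inv_into A f u)) ` f ` A"
    unfolding image_comp by (intro image_cong) auto
  then show ?thesis using assms(2) by (simp add: card_image_le)
qed

text \<open>The difference of the fractional coordinates of \<open>x\<close> and \<open>y\<close> gives a vector of \<open>L\<close> shorter
  than every basis vector, hence zero.\<close>
lemma diff_in_sublattice_if_close:
  fixes f :: "'n::finite \<Rightarrow> real^'n"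
  defines "V \<equiv> column_matrix f"
  assumes V: "invertible V" and L: "add_subgroup L" and L': "add_subgroup L'"
    and sub: "L' \<subseteq> L" "lattice_of V \<subseteq> L'"
    and short: "\<And>i w. w \<in> L \<Longrightarrow> w \<noteq> 0 \<Longrightarrow> norm (f i) \<le> norm w"
    and xy: "x \<in> L" "y \<in> L"
    and close: "\<And>i. \<bar>(vec_frac (matrix_inv V *v x) - vec_frac (matrix_inv V *v y)) $ i\<bar>
                   < 1 / CARD('n)"
  shows "x - y \<in> L'"
proof -
  define t where "t = matrix_inv V *v x"
  define s where "s = matrix_inv V *v y"
  define \<delta> where "\<delta> = vec_frac t - vec_frac s"
  have int_part_in: "V *v (z - vec_frac z) \<in> L'" for z
    using sub(2) V by (simp add: mult_in_lattice_of_iff int_vec_diff_vec_frac subset_iff)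
  have u_eq: "V *v \<delta> = (x - V *v (t - vec_frac t)) - (y - V *v (s - vec_frac s))"
    using V by (simp add: \<delta>_def t_def s_def matrix_inv_vector_right matrix_vector_mult_diff_distrib)
  have "V *v \<delta> \<in> L"
    unfolding u_eq using int_part_in sub(1) xy by (blast intro: add_subgroup_diff[OF L])
  have "V *v \<delta> = 0"
  proof (rule ccontr)
    assume u0: "V *v \<delta> \<noteq> 0"
    have "norm (V *v \<delta>) \<le> (\<Sum>c\<in>UNIV. \<bar>\<delta> $ c\<bar> * norm (f c))"
      unfolding V_def column_matrix_mult by (rule order_trans[OF norm_sum]) simp
    also have "\<dots> < (\<Sum>c\<in>(UNIV::'n set). 1 / CARD('n) * norm (V *v \<delta>))"
    proof (intro sum_strict_mono)
      fix c :: 'n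
      have "\<bar>\<delta> $ c\<bar> * norm (f c) \<le> \<bar>\<delta> $ c\<bar> * norm (V *v \<delta>)"
        using short[OF \<open>V *v \<delta> \<in> L\<close> u0] by (simp add: mult_left_mono)
      also have "\<dots> < 1 / CARD('n) * norm (V *v \<delta>)"
        using close[of c] u0 by (intro mult_strict_right_mono) (auto simp: \<delta>_def t_def s_def)
      finally show "\<bar>\<delta> $ c\<bar> * norm (f c) < 1 / CARD('n) * norm (V *v \<delta>)" .
    qed auto
    also have "\<dots> = norm (V *v \<delta>)" by simp
    finally show False by simp
  qed
  then have "x - y = V *v (t - vec_frac t) - V *v (s - vec_frac s)"
    using u_eq by (simp add: algebra_simps)
  then show ?thesis using int_part_in add_subgroup_diff[OF L'] by metis
qed

lemma card_cosets_short_basis: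
  fixes f :: "'n::finite \<Rightarrow> real^'n"
  defines "V \<equiv> column_matrix f"
  assumes V: "invertible V" and L: "add_subgroup L" and L': "add_subgroup L'"
    and sub: "L' \<subseteq> L" "lattice_of V \<subseteq> L'"
    and short: "\<And>i w. w \<in> L \<Longrightarrow> w \<noteq> 0 \<Longrightarrow> norm (f i) \<le> norm w"
  shows "finite ((\<lambda>v. {w \<in> L. w - v \<in> L'}) ` L) \<and>
         card ((\<lambda>v. {w \<in> L. w - v \<in> L'}) ` L) \<le> CARD('n) ^ CARD('n)"
proof -
  define d where "d = CARD('n)"
  define cell where "cell x = (\<lambda>i. \<lfloor>real d * vec_frac (matrix_inv V *v x) $ i\<rfloor>)" for x
  have "0 \<le> real d * vec_frac z $ i" "real d * vec_frac z $ i < real d" for z :: "real^'n" and i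
    using vec_frac_bounds[of z i] by (simp_all add: d_def)
  then have cell_range: "cell ` L \<subseteq> UNIV \<rightarrow>\<^sub>E {0..<int d}"
    unfolding cell_def PiE_UNIV_domain by (auto simp: floor_less_iff)
  have same_coset: "{w \<in> L. w - x \<in> L'} = {w \<in> L. w - y \<in> L'}"
    if "x \<in> L" "y \<in> L" "cell x = cell y" for x y
  proof -
    have "real d * \<bar>(vec_frac (matrix_inv V *v x) - vec_frac (matrix_inv V *v y)) $ i\<bar> < 1" for i
    proof -
      have "\<bar>real d * vec_frac (matrix_inv V *v x) $ i - real d * vec_frac (matrix_inv V *v y) $ i\<bar> < 1"
        using fun_cong[OF that(3), of i] unfolding cell_def by linarith
      then show ?thesis by (simp add: abs_mult_pos' right_diff_distrib)
    qed
    then have "\<bar>(vec_frac (matrix_inv V *v x) - vec_frac (matrix_inv V *v y)) $ i\<bar> < 1 / CARD('n)" for i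
      by (simp add: d_def mult.commute pos_less_divide_eq)
    then show ?thesis
      using diff_in_sublattice_if_close[OF V[unfolded V_def] L L' sub[unfolded V_def] short that(1,2)]
        coset_eq_iff[OF L' sub(1) that(1,2)] by (simp add: V_def)
  qed
  have finite_cells: "finite (UNIV \<rightarrow>\<^sub>E {0..<int d} :: ('n \<Rightarrow> int) set)"
    by (simp add: finite_PiE)
  have "card (UNIV \<rightarrow>\<^sub>E {0..<int d} :: ('n \<Rightarrow> int) set) = d ^ d"
    by (simp add: card_PiE d_def)
  then have "card (cell ` L) \<le> d ^ d"
    using card_mono[OF finite_cells cell_range] by simp
  moreover note card_image_le_if_factors[of L cell "\<lambda>v. {w \<in> L. w - v \<in> L'}", OF same_coset finite_subset[OF cell_range finite_cells]]
  ultimately show ?thesis unfolding d_def by linarith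
qed

lemma spanning_set_contains_basis:
  assumes "span S = (UNIV :: (real^'n::finite) set)"
  obtains g :: "'n \<Rightarrow> real^'n" where "\<And>i. g i \<in> S" "invertible (column_matrix g)"
proof -
  obtain B where B: "B \<subseteq> S" "independent B" "S \<subseteq> span B"
    using maximal_independent_subset[of S] by blast
  have spB: "span B = UNIV" using assms span_minimal[OF B(3) subspace_span] by auto
  have finB: "finite B" using B(2) by (simp add: independent_bound)
  have "card B = CARD('n)" using basis_card_eq_dim[of B UNIV] B spB by simp
  then obtain g where g: "bij_betw g (UNIV::'n set) B"
    using finite_same_card_bij[of "UNIV::'n set" B] finB by auto
  have "y \<in> range ((*v) (column_matrix g))" for y
  proof -
    obtain u where "y = (\<Sum>v\<in>B. u v *\<^sub>R v)" using spB span_finite[OF finB] by auto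
    also have "\<dots> = column_matrix g *v (\<chi> c. u (g c))"
      using sum.reindex_bij_betw[OF g, of "\<lambda>v. u v *\<^sub>R v"] by (simp add: column_matrix_mult)
    finally show ?thesis by simp
  qed
  then have "invertible (column_matrix g)"
    using matrix_right_invertible_surjective invertible_right_inverse by blast
  then show thesis using that g B(1) bij_betwE by blast
qed

lemma lat_index_le_power:
  fixes L L' :: "(real^'n::finite) set"
  assumes L: "is_lattice L" and L': "is_lattice L'" and sub: "L' \<subseteq> L"
    and wr: "well_rounded L'" and mv: "min_vecs L' \<subseteq> min_vecs L"
  shows "finite ((\<lambda>v. {w \<in> L. w - v \<in> L'}) ` L) \<and> lat_index L L' \<le> CARD('n) ^ CARD('n)"
proof -
  have subgroups: "add_subgroup L" "add_subgroup L'"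
    using L L' add_subgroup_lattice_of by (auto simp: is_lattice_iff)
  obtain g where g: "\<And>i. g i \<in> min_vecs L'" "invertible (column_matrix g)"
    using spanning_set_contains_basis wr unfolding well_rounded_def by metis
  have "lattice_of (column_matrix g) \<subseteq> L'"
    using g by (intro lattice_of_column_matrix_subset subgroups) (auto simp: min_vecs_def)
  moreover have "norm (g i) \<le> norm w" if "w \<in> L" "w \<noteq> 0" for i w
    using g(1) mv min_vecs_le that by blast
  ultimately show ?thesis
    using card_cosets_short_basis[OF g(2) subgroups sub] unfolding lat_index_def by blast
qed

lemma lat_index_le_I_const:
  fixes L L' :: "(real^'n::finite) set"
  assumes "is_lattice L" "is_lattice L'" "L' \<subseteq> L" "well_rounded L'" "min_vecs L' \<subseteq> min_vecs L"
  shows "lat_index L L' \<le> I_const TYPE('n)"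
proof -
  let ?bound = "\<lambda>k. \<forall>(L::(real^'n) set) L'. is_lattice L \<and> is_lattice L' \<and> L' \<subseteq> L
      \<and> well_rounded L' \<and> min_vecs L' \<subseteq> min_vecs L \<longrightarrow> lat_index L L' \<le> k"
  have "?bound (CARD('n) ^ CARD('n))" using lat_index_le_power by blast
  then have "?bound (LEAST k. ?bound k)" by (rule LeastI)
  then show ?thesis unfolding I_const_def using assms by blast
qed

section \<open>Hermite normal forms of overlattices of the integer lattice\<close>

definition hnf_params :: "nat \<Rightarrow> nat \<Rightarrow> ((nat \<Rightarrow> nat) \<times> (nat \<Rightarrow> nat \<Rightarrow> nat)) set" where
  "hnf_params d I = {(a, k). a \<in> {..<d} \<rightarrow>\<^sub>E {1..} \<and> prod a {..<d} \<le> I \<and>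
     k \<in> (\<Pi>\<^sub>E j\<in>{..<d}. {..<j} \<rightarrow>\<^sub>E {..<a j})}"

lemma restrict_lessThan_upd:
  assumes "f \<in> (\<Pi>\<^sub>E j\<in>{..<Suc d}. B j)"
  shows "(restrict f {..<d})(d := f d) = f"
proof
  fix x
  show "((restrict f {..<d})(d := f d)) x = f x"
    using PiE_arb[OF assms, of x] by (cases "x < Suc d") auto
qed

lemma hnf_params_Suc_subset:
  "hnf_params (Suc d) I \<subseteq> (\<lambda>(e, \<kappa>, (a, k)). (a(d := e), k(d := \<kappa>))) `
     (SIGMA e:{1..I}. ({..<d} \<rightarrow>\<^sub>E {..<e}) \<times> hnf_params d (I div e))"
  (is "_ \<subseteq> ?extend ` ?Sig")
proof
  fix p assume "p \<in> hnf_params (Suc d) I"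
  then obtain a k where p: "p = (a, k)" and a: "a \<in> {..<Suc d} \<rightarrow>\<^sub>E {1..}"
    and prod: "prod a {..<d} * a d \<le> I" and k: "k \<in> (\<Pi>\<^sub>E j\<in>{..<Suc d}. {..<j} \<rightarrow>\<^sub>E {..<a j})"
    unfolding hnf_params_def by (auto simp: mult.commute)
  define a' where "a' = restrict a {..<d}"
  define k' where "k' = restrict k {..<d}"
  have a': "a' \<in> {..<d} \<rightarrow>\<^sub>E {1..}"
    unfolding a'_def by (rule restrict_PiE_iff[THEN iffD2]) (use PiE_mem[OF a] in simp)
  have prod_eq: "prod a' {..<d} = prod a {..<d}" by (simp add: a'_def)
  have "1 \<le> prod a' {..<d}" using PiE_mem[OF a'] by (intro prod_ge_1) auto
  then have "a d \<le> prod a {..<d} * a d" unfolding prod_eq by (metis mult_le_mono1 mult_1)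
  then have "a d \<le> I" using prod by linarith
  moreover have "1 \<le> a d" using PiE_mem[OF a, of d] by simp
  ultimately have e: "a d \<in> {1..I}" "prod a' {..<d} \<le> I div a d"
    using prod by (simp_all add: prod_eq less_eq_div_iff_mult_less_eq)
  have "k' \<in> (\<Pi>\<^sub>E j\<in>{..<d}. {..<j} \<rightarrow>\<^sub>E {..<a' j})"
    unfolding k'_def by (rule restrict_PiE_iff[THEN iffD2]) (use PiE_mem[OF k] in \<open>simp add: a'_def\<close>)
  then have "(a', k') \<in> hnf_params d (I div a d)"
    using a' e(2) by (simp add: hnf_params_def)
  moreover have "k d \<in> {..<d} \<rightarrow>\<^sub>E {..<a d}" using PiE_mem[OF k, of d] by simp
  moreover have "?extend (a d, k d, (a', k')) = p"
    using restrict_lessThan_upd[OF a] restrict_lessThan_upd[OF k]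
    by (simp add: p a'_def k'_def)
  ultimately have "(a d, k d, (a', k')) \<in> ?Sig" "p = ?extend (a d, k d, (a', k'))"
    using e(1) by auto
  then show "p \<in> ?extend ` ?Sig" by (intro image_eqI)
qed

lemma card_hnf_params: "finite (hnf_params d I) \<and> card (hnf_params d I) \<le> I ^ d"
proof (induction d arbitrary: I)
  case 0
  have sub: "hnf_params 0 I \<subseteq> {(\<lambda>_. undefined, \<lambda>_. undefined)}" by (auto simp: hnf_params_def)
  then have "card (hnf_params 0 I) \<le> card {(\<lambda>_::nat. undefined::nat, \<lambda>_::nat. undefined::nat \<Rightarrow> nat)}"
    by (intro card_mono) auto
  then show ?case using finite_subset[OF sub] by simp
next
  case (Suc d)
  define Sig where "Sig = (SIGMA e:{1..I}. ({..<d} \<rightarrow>\<^sub>E {..<e}) \<times> hnf_params d (I div e))"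
  have "hnf_params (Suc d) I \<subseteq> (\<lambda>(e, \<kappa>, (a, k)). (a(d := e), k(d := \<kappa>))) ` Sig"
    unfolding Sig_def by (rule hnf_params_Suc_subset)
  moreover have "finite Sig"
    unfolding Sig_def by (intro finite_SigmaI finite_cartesian_product finite_PiE) (simp_all add: Suc.IH)
  moreover have "card Sig \<le> I ^ Suc d"
  proof -
    have "card Sig = (\<Sum>e\<in>{1..I}. card (({..<d} \<rightarrow>\<^sub>E {..<e}) \<times> hnf_params d (I div e)))"
      unfolding Sig_def using Suc.IH by (intro card_SigmaI) (auto intro!: finite_PiE)
    also have "\<dots> = (\<Sum>e\<in>{1..I}. e ^ d * card (hnf_params d (I div e)))"
      by (intro sum.cong refl) (simp add: card_cartesian_product card_funcsetE)
    also have "\<dots> \<le> (\<Sum>e\<in>{1..I}. (e * (I div e)) ^ d)"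
      using Suc.IH by (intro sum_mono) (simp add: power_mult_distrib)
    also have "\<dots> \<le> (\<Sum>e\<in>{1..I}. I ^ d)"
      by (intro sum_mono power_mono) simp_all
    finally show ?thesis by simp
  qed
  ultimately show ?case by (meson card_image_le card_mono finite_imageI finite_subset order_trans)
qed

text \<open>With the coordinates ordered by \<open>\<sigma>\<close>, the vectors \<open>b\<^sub>j = hnf_vec \<sigma> a k j\<close> are determined by
  \<open>e\<^bsub>\<sigma> j\<^esub> = a\<^sub>j b\<^sub>j - (\<Sum>i<j. k\<^sub>j\<^sub>i b\<^sub>i)\<close>: the rows of the Hermite normal form expressing the
  standard basis in a basis of an overlattice of \<open>\<int>\<^sup>d\<close>.\<close>
fun hnf_vec :: "(nat \<Rightarrow> 'n::finite) \<Rightarrow> (nat \<Rightarrow> nat) \<Rightarrow> (nat \<Rightarrow> nat \<Rightarrow> nat) \<Rightarrow> nat \<Rightarrow> real^'n" where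
  "hnf_vec \<sigma> a k j = (1 / real (a j)) *\<^sub>R (axis (\<sigma> j) 1 + (\<Sum>i<j. real (k j i) *\<^sub>R hnf_vec \<sigma> a k i))"

declare hnf_vec.simps [simp del]

definition hnf_lattice :: "(nat \<Rightarrow> 'n::finite) \<Rightarrow> (nat \<Rightarrow> nat) \<Rightarrow> (nat \<Rightarrow> nat \<Rightarrow> nat) \<Rightarrow> nat \<Rightarrow> (real^'n) set"
  where "hnf_lattice \<sigma> a k m = {\<Sum>j<m. of_int (t j) *\<^sub>R hnf_vec \<sigma> a k j | t. True}"

definition vanishes_from :: "(nat \<Rightarrow> 'n::finite) \<Rightarrow> nat \<Rightarrow> real^'n \<Rightarrow> bool" where
  "vanishes_from \<sigma> m x \<longleftrightarrow> (\<forall>l. m \<le> l \<and> l < CARD('n) \<longrightarrow> x $ \<sigma> l = 0)"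

lemma add_subgroup_vanishes_from: "add_subgroup (Collect (vanishes_from \<sigma> m))"
  by (simp add: add_subgroup_def vanishes_from_def)

lemma vanishes_from_Suc:
  assumes "vanishes_from \<sigma> (Suc m) x" "x $ \<sigma> m = 0"
  shows "vanishes_from \<sigma> m x"
  unfolding vanishes_from_def
proof (intro allI impI)
  fix l assume "m \<le> l \<and> l < CARD('a)"
  then show "x $ \<sigma> l = 0" using assms by (cases "l = m") (auto simp: vanishes_from_def)
qed

lemma vanishes_from_diff:
  "vanishes_from \<sigma> m x \<Longrightarrow> vanishes_from \<sigma> m y \<Longrightarrow> vanishes_from \<sigma> m (c *\<^sub>R x - d *\<^sub>R y)"
  by (simp add: vanishes_from_def)

lemma hnf_vec_cong:
  "(\<And>i. i \<le> j \<Longrightarrow> a i = a' i \<and> k i = k' i) \<Longrightarrow> hnf_vec \<sigma> a k j = hnf_vec \<sigma> a' k' j"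
proof (induction j rule: less_induct)
  case (less j)
  then show ?case by (subst (1 2) hnf_vec.simps) (auto intro!: sum.cong)
qed

lemma hnf_vec_vanishes_from:
  fixes \<sigma> :: "nat \<Rightarrow> 'n::finite"
  assumes \<sigma>: "inj_on \<sigma> {..<CARD('n)}"
  shows "vanishes_from \<sigma> (Suc j) (hnf_vec \<sigma> a k j)"
proof (induction j rule: less_induct)
  case (less j)
  show ?case unfolding vanishes_from_def
  proof (intro allI impI)
    fix l assume l: "Suc j \<le> l \<and> l < CARD('n)"
    then have "\<sigma> l \<noteq> \<sigma> j" using inj_onD[OF \<sigma>, of l j] by auto
    then have "axis (\<sigma> j) 1 $ \<sigma> l = (0::real)" by (simp add: axis_def)
    moreover have "hnf_vec \<sigma> a k i $ \<sigma> l = 0" if "i < j" for i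
      using less.IH[OF that] l that by (simp add: vanishes_from_def)
    ultimately show "hnf_vec \<sigma> a k j $ \<sigma> l = 0"
      by (subst hnf_vec.simps) (simp add: sum_component axis_nth)
  qed
qed

lemma hnf_vec_diag:
  fixes \<sigma> :: "nat \<Rightarrow> 'n::finite"
  assumes \<sigma>: "inj_on \<sigma> {..<CARD('n)}" and j: "j < CARD('n)"
  shows "hnf_vec \<sigma> a k j $ \<sigma> j = 1 / real (a j)"
proof -
  have "hnf_vec \<sigma> a k i $ \<sigma> j = 0" if "i < j" for i
    using hnf_vec_vanishes_from[OF \<sigma>, of i] that j by (simp add: vanishes_from_def)
  then show ?thesis by (subst hnf_vec.simps) (simp add: sum_component)
qed

lemma hnf_combination_component:
  fixes \<sigma> :: "nat \<Rightarrow> 'n::finite"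
  assumes \<sigma>: "inj_on \<sigma> {..<CARD('n)}" and j0: "j0 < CARD('n)"
    and above: "\<And>j. j0 < j \<Longrightarrow> j < CARD('n) \<Longrightarrow> s j = 0"
  shows "(\<Sum>j<CARD('n). of_int (s j) *\<^sub>R hnf_vec \<sigma> a k j) $ \<sigma> j0 = of_int (s j0) / real (a j0)"
proof -
  have "of_int (s j) * hnf_vec \<sigma> a k j $ \<sigma> j0 = 0" if "j < CARD('n)" "j \<noteq> j0" for j
  proof (cases "j < j0")
    case True
    then show ?thesis using hnf_vec_vanishes_from[OF \<sigma>, of j] j0 by (simp add: vanishes_from_def)
  qed (use that above in simp)
  then have "(\<Sum>j\<in>{..<CARD('n)} - {j0}. of_int (s j) * hnf_vec \<sigma> a k j $ \<sigma> j0) = 0"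
    by (intro sum.neutral ballI) blast
  then have "(\<Sum>j<CARD('n). of_int (s j) * hnf_vec \<sigma> a k j $ \<sigma> j0) =
      of_int (s j0) * hnf_vec \<sigma> a k j0 $ \<sigma> j0"
    using j0 by (simp add: sum.remove)
  then show ?thesis by (simp add: sum_component hnf_vec_diag[OF \<sigma> j0])
qed

lemma of_int_divide_notin_Ints:
  assumes "s \<noteq> 0" "\<bar>s\<bar> < int a"
  shows "of_int s / real a \<notin> \<int>"
proof
  assume "of_int s / real a \<in> \<int>"
  then obtain z where z: "of_int s / real a = of_int z" by (auto elim: Ints_cases)
  have "real a > 0" using assms by simp
  then have "of_int s = of_int z * real a" using z by (simp add: divide_eq_eq)
  then have sz: "s = z * int a" by (metis of_int_eq_iff of_int_mult of_int_of_nat_eq)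
  then have "z \<noteq> 0" using assms(1) by auto
  then have "\<bar>z\<bar> * int a \<ge> int a" using \<open>real a > 0\<close> by (simp add: mult_le_cancel_right1)
  then show False using assms(2) sz by (simp add: abs_mult)
qed

lemma inj_on_hnf_frac:
  fixes \<sigma> :: "nat \<Rightarrow> 'n::finite"
  assumes \<sigma>: "inj_on \<sigma> {..<CARD('n)}"
  shows "inj_on (\<lambda>t. vec_frac (\<Sum>j<CARD('n). real (t j) *\<^sub>R hnf_vec \<sigma> a k j))
    (\<Pi>\<^sub>E j\<in>{..<CARD('n)}. {..<a j})"
proof (rule inj_onI, rule ccontr)
  fix t t' assume t: "t \<in> (\<Pi>\<^sub>E j\<in>{..<CARD('n)}. {..<a j})" "t' \<in> (\<Pi>\<^sub>E j\<in>{..<CARD('n)}. {..<a j})"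
    and eq: "vec_frac (\<Sum>j<CARD('n). real (t j) *\<^sub>R hnf_vec \<sigma> a k j) =
      vec_frac (\<Sum>j<CARD('n). real (t' j) *\<^sub>R hnf_vec \<sigma> a k j)" and "t \<noteq> t'"
  define J where "J = {j. j < CARD('n) \<and> t j \<noteq> t' j}"
  have finJ: "finite J" by (simp add: J_def)
  have "J \<noteq> {}"
    using \<open>t \<noteq> t'\<close> PiE_ext[OF t] unfolding J_def by auto
  define j0 where "j0 = Max J"
  have "j0 \<in> J" unfolding j0_def using finJ \<open>J \<noteq> {}\<close> by (rule Max_in)
  then have j0: "j0 < CARD('n)" "t j0 \<noteq> t' j0" by (auto simp: J_def)
  define s where "s j = int (t j) - int (t' j)" for j
  have above: "s j = 0" if "j0 < j" "j < CARD('n)" for j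
  proof (rule ccontr)
    assume "s j \<noteq> 0"
    then have "j \<in> J" using that by (auto simp: J_def s_def)
    then show False using Max_ge[OF finJ] that unfolding j0_def by fastforce
  qed
  have "(\<Sum>j<CARD('n). real (t j) *\<^sub>R hnf_vec \<sigma> a k j) - (\<Sum>j<CARD('n). real (t' j) *\<^sub>R hnf_vec \<sigma> a k j)
      = (\<Sum>j<CARD('n). of_int (s j) *\<^sub>R hnf_vec \<sigma> a k j)"
    by (simp add: s_def sum_subtractf[symmetric] scaleR_diff_left)
  then have "int_vec (\<Sum>j<CARD('n). of_int (s j) *\<^sub>R hnf_vec \<sigma> a k j)"
    using eq by (simp add: vec_frac_eq_iff)
  then have "(\<Sum>j<CARD('n). of_int (s j) *\<^sub>R hnf_vec \<sigma> a k j) $ \<sigma> j0 \<in> \<int>"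
    unfolding int_vec_def by (rule spec)
  then have "of_int (s j0) / real (a j0) \<in> \<int>"
    by (simp only: hnf_combination_component[OF \<sigma> j0(1), where s = s, OF above])
  moreover have "t j0 < a j0" "t' j0 < a j0" using t j0(1) by (auto dest: PiE_mem)
  then have "s j0 \<noteq> 0" "\<bar>s j0\<bar> < int (a j0)" using j0(2) by (auto simp: s_def)
  ultimately show False using of_int_divide_notin_Ints by blast
qed

lemma discrete_add_subgroup_real:
  fixes P :: "real set"
  assumes P: "add_subgroup P" and P1: "1 \<in> P" and fin: "finite {p \<in> P. 0 < p \<and> p < 1}"
  obtains n :: nat where "n \<ge> 1" "1 / real n \<in> P" "\<And>p. p \<in> P \<Longrightarrow> \<exists>z::int. p = of_int z / real n"
proof -
  define Q where "Q = {p \<in> P. 0 < p \<and> p \<le> 1}"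
  have "Q \<subseteq> insert 1 {p \<in> P. 0 < p \<and> p < 1}" unfolding Q_def by auto
  then have finQ: "finite Q" using fin finite_subset by blast
  have "1 \<in> Q" using P1 unfolding Q_def by simp
  define t where "t = Min Q"
  have tQ: "t \<in> Q" unfolding t_def using finQ \<open>1 \<in> Q\<close> by (intro Min_in) auto
  then have tP: "t \<in> P" and t0: "0 < t" and t1: "t \<le> 1" unfolding Q_def by auto
  have rep: "p = of_int \<lfloor>p / t\<rfloor> * t" if "p \<in> P" for p
  proof -
    text \<open>The remainder of \<open>p\<close> modulo \<open>t\<close> lies in \<open>P \<inter> [0, t)\<close>, and \<open>t\<close> is the least positive element.\<close>
    define r where "r = p - of_int \<lfloor>p / t\<rfloor> * t"
    have "r \<in> P" unfolding r_def
      using add_subgroup_diff[OF P that add_subgroup_of_int_scaleR[OF P tP]] by simp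
    moreover have "0 \<le> r" "r < t"
      using t0 floor_divide_lower[OF t0, of p] floor_divide_upper[OF t0, of p]
      by (simp_all add: r_def algebra_simps)
    ultimately have "r = 0" using Min_le[OF finQ, of r] t1 unfolding Q_def t_def by force
    then show ?thesis unfolding r_def by simp
  qed
  define z where "z = \<lfloor>1 / t\<rfloor>"
  have "1 \<le> 1 / t" using t0 t1 by simp
  then have "1 \<le> z" unfolding z_def by linarith
  define n where "n = nat z"
  have n1: "n \<ge> 1" and "real n = of_int z" using \<open>1 \<le> z\<close> unfolding n_def by auto
  then have "1 = real n * t" using rep[OF P1] by (simp add: z_def)
  then have tn: "t = 1 / real n" using n1 by (simp add: field_simps)
  show thesis
  proof
    show "n \<ge> 1" "1 / real n \<in> P" using n1 tP tn by auto
    show "\<exists>z::int. p = of_int z / real n" if "p \<in> P" for p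
      using rep[OF that] tn by (metis times_divide_eq_right mult_1_right)
  qed
qed

definition hnf_prefix ::
    "(nat \<Rightarrow> 'n::finite) \<Rightarrow> (real^'n) set \<Rightarrow> nat \<Rightarrow> (nat \<Rightarrow> nat) \<Rightarrow> (nat \<Rightarrow> nat \<Rightarrow> nat) \<Rightarrow> bool" where
  "hnf_prefix \<sigma> M m a k \<longleftrightarrow> a \<in> {..<m} \<rightarrow>\<^sub>E {1..} \<and> k \<in> (\<Pi>\<^sub>E j\<in>{..<m}. {..<j} \<rightarrow>\<^sub>E {..<a j}) \<and>
     (\<forall>j<m. hnf_vec \<sigma> a k j \<in> M) \<and> (\<forall>x\<in>M. vanishes_from \<sigma> m x \<longrightarrow> x \<in> hnf_lattice \<sigma> a k m)"

lemma hnf_vec_extend: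
  fixes \<sigma> :: "nat \<Rightarrow> 'n::finite"
  assumes n: "n \<ge> 1"
    and c: "real n *\<^sub>R y - axis (\<sigma> m) 1 = (\<Sum>j<m. of_int (c j) *\<^sub>R hnf_vec \<sigma> a k j)"
  defines "a' \<equiv> a(m := n)" and "k' \<equiv> k(m := restrict (\<lambda>i. nat (c i mod int n)) {..<m})"
  shows "\<And>j. j < m \<Longrightarrow> hnf_vec \<sigma> a' k' j = hnf_vec \<sigma> a k j"
    and "hnf_vec \<sigma> a' k' m = y - (\<Sum>j<m. of_int (c j div int n) *\<^sub>R hnf_vec \<sigma> a k j)"
proof -
  show same: "hnf_vec \<sigma> a' k' j = hnf_vec \<sigma> a k j" if "j < m" for j
    using that by (intro hnf_vec_cong) (simp add: a'_def k'_def)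
  define b where "b = hnf_vec \<sigma> a k"
  define q where "q i = c i div int n" for i
  have c_eq: "of_int (c i) = real n * of_int (q i) + real (k' m i)" if "i < m" for i
  proof -
    have "c i = int n * q i + c i mod int n" unfolding q_def by simp
    moreover have "c i mod int n \<ge> 0" using n by simp
    ultimately show ?thesis
      using that by (simp add: k'_def) (metis of_int_add of_int_mult of_int_of_nat_eq)
  qed
  have "(\<Sum>j<m. of_int (c j) *\<^sub>R b j) = (\<Sum>j<m. real n *\<^sub>R (of_int (q j) *\<^sub>R b j) + real (k' m j) *\<^sub>R b j)"
    by (intro sum.cong refl) (simp add: c_eq scaleR_add_left)
  also have "\<dots> = real n *\<^sub>R (\<Sum>j<m. of_int (q j) *\<^sub>R b j) + (\<Sum>j<m. real (k' m j) *\<^sub>R b j)"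
    by (simp add: sum.distrib scaleR_sum_right)
  finally have "axis (\<sigma> m) 1 + (\<Sum>j<m. real (k' m j) *\<^sub>R b j) = real n *\<^sub>R (y - (\<Sum>j<m. of_int (q j) *\<^sub>R b j))"
    using c unfolding b_def by (simp add: algebra_simps)
  moreover have "(\<Sum>j<m. real (k' m j) *\<^sub>R hnf_vec \<sigma> a' k' j) = (\<Sum>j<m. real (k' m j) *\<^sub>R b j)"
    using same by (simp add: b_def)
  ultimately show "hnf_vec \<sigma> a' k' m = y - (\<Sum>j<m. of_int (c j div int n) *\<^sub>R hnf_vec \<sigma> a k j)"
    using n by (subst hnf_vec.simps) (simp add: a'_def b_def q_def)
qed

lemma hnf_lattice_Suc:
  assumes "x - of_int z *\<^sub>R hnf_vec \<sigma> a' k' m \<in> hnf_lattice \<sigma> a k m"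
    and "\<And>j. j < m \<Longrightarrow> hnf_vec \<sigma> a' k' j = hnf_vec \<sigma> a k j"
  shows "x \<in> hnf_lattice \<sigma> a' k' (Suc m)"
proof -
  obtain t where t: "x - of_int z *\<^sub>R hnf_vec \<sigma> a' k' m = (\<Sum>j<m. of_int (t j) *\<^sub>R hnf_vec \<sigma> a k j)"
    using assms(1) unfolding hnf_lattice_def by blast
  have "(\<Sum>j<m. of_int (t j) *\<^sub>R hnf_vec \<sigma> a k j) = (\<Sum>j<m. of_int ((t(m := z)) j) *\<^sub>R hnf_vec \<sigma> a' k' j)"
    using assms(2) by (intro sum.cong) auto
  then have "x = (\<Sum>j<Suc m. of_int ((t(m := z)) j) *\<^sub>R hnf_vec \<sigma> a' k' j)"
    using t by (simp add: algebra_simps)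
  then show ?thesis unfolding hnf_lattice_def by blast
qed

locale overlattice =
  fixes \<sigma> :: "nat \<Rightarrow> 'n::finite" and M :: "(real^'n) set"
  assumes \<sigma>: "bij_betw \<sigma> {..<CARD('n)} UNIV"
    and M: "add_subgroup M"
    and int_vec_in: "\<And>x. int_vec x \<Longrightarrow> x \<in> M"
    and finite_frac: "finite (vec_frac ` M)"
begin

lemma inj_\<sigma>: "inj_on \<sigma> {..<CARD('n)}"
  using \<sigma> by (rule bij_betw_imp_inj_on)

lemma vanishes_from_axis:
  assumes "m < CARD('n)"
  shows "vanishes_from \<sigma> (Suc m) (axis (\<sigma> m) 1)"
  unfolding vanishes_from_def
proof (intro allI impI)
  fix l assume "Suc m \<le> l \<and> l < CARD('n)"
  then have "\<sigma> l \<noteq> \<sigma> m" using inj_onD[OF inj_\<sigma>, of l m] assms by auto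
  then show "axis (\<sigma> m) 1 $ \<sigma> l = 0" by (simp add: axis_def)
qed

lemma hnf_prefix_0: "hnf_prefix \<sigma> M 0 (\<lambda>_. undefined) (\<lambda>_. undefined)"
proof -
  have "x = 0" if "vanishes_from \<sigma> 0 x" for x
  proof (unfold vec_eq_iff, rule allI)
    fix i
    have "i \<in> \<sigma> ` {..<CARD('n)}" using bij_betw_imp_surj_on[OF \<sigma>] by simp
    then obtain l where "l < CARD('n)" "\<sigma> l = i" by auto
    then show "x $ i = 0 $ i" using that by (auto simp: vanishes_from_def)
  qed
  then show ?thesis by (auto simp: hnf_prefix_def hnf_lattice_def)
qed

lemma hnf_pivot:
  assumes m: "m < CARD('n)"
  obtains n :: nat and y where "n \<ge> 1" "y \<in> M" "vanishes_from \<sigma> (Suc m) y" "y $ \<sigma> m = 1 / real n"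
    "\<And>x. x \<in> M \<Longrightarrow> vanishes_from \<sigma> (Suc m) x \<Longrightarrow> \<exists>z::int. x $ \<sigma> m = of_int z / real n"
proof -
  define P where "P = (\<lambda>x. x $ \<sigma> m) ` (M \<inter> Collect (vanishes_from \<sigma> (Suc m)))"
  have "linear (\<lambda>x::real^'n. x $ \<sigma> m)" by (simp add: linear_iff)
  then have "add_subgroup P" unfolding P_def
    by (intro add_subgroup_image_linear add_subgroup_Int M add_subgroup_vanishes_from)
  moreover have "1 \<in> P"
  proof -
    show ?thesis using int_vec_in[OF int_vec_axis] vanishes_from_axis[OF m] unfolding P_def by force
  qed
  moreover have "finite {p \<in> P. 0 < p \<and> p < 1}"
  proof (rule finite_subset[OF _ finite_imageI[OF finite_frac]])
    show "{p \<in> P. 0 < p \<and> p < 1} \<subseteq> (\<lambda>v. v $ \<sigma> m) ` vec_frac ` M"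
    proof
      fix p assume "p \<in> {p \<in> P. 0 < p \<and> p < 1}"
      then obtain x where x: "x \<in> M" "p = x $ \<sigma> m" "0 < p" "p < 1" unfolding P_def by auto
      then have "vec_frac x $ \<sigma> m = p" by (simp add: vec_frac_def vec_floor_def floor_eq_iff)
      then show "p \<in> (\<lambda>v. v $ \<sigma> m) ` vec_frac ` M" using x(1) by (metis image_eqI)
    qed
  qed
  ultimately obtain n where "n \<ge> 1" "1 / real n \<in> P" "\<And>p. p \<in> P \<Longrightarrow> \<exists>z::int. p = of_int z / real n"
    using discrete_add_subgroup_real by blast
  then show thesis using that unfolding P_def by auto
qed

lemma hnf_prefix_Suc:
  assumes m: "m < CARD('n)" and H: "hnf_prefix \<sigma> M m a k"
  obtains a' k' where "hnf_prefix \<sigma> M (Suc m) a' k'"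
proof -
  obtain n y where n: "n \<ge> 1" and y: "y \<in> M" "vanishes_from \<sigma> (Suc m) y" "y $ \<sigma> m = 1 / real n"
    and pivot: "\<And>x. x \<in> M \<Longrightarrow> vanishes_from \<sigma> (Suc m) x \<Longrightarrow> \<exists>z::int. x $ \<sigma> m = of_int z / real n"
    using hnf_pivot[OF m] by blast
  have ax: "axis (\<sigma> m) 1 \<in> M" "vanishes_from \<sigma> (Suc m) (axis (\<sigma> m) 1)"
    using int_vec_in[OF int_vec_axis] vanishes_from_axis[OF m] by auto
  text \<open>\<open>n y - e\<^bsub>\<sigma> m\<^esub>\<close> vanishes from \<open>m\<close> on, so it is an integer combination of the \<open>b\<^sub>j\<close>, \<open>j < m\<close>.\<close>
  have "real n *\<^sub>R y - axis (\<sigma> m) 1 \<in> M"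
    using add_subgroup_diff[OF M add_subgroup_of_int_scaleR[OF M y(1), of "int n"] ax(1)] by simp
  moreover have "vanishes_from \<sigma> m (real n *\<^sub>R y - axis (\<sigma> m) 1)"
    by (rule vanishes_from_Suc) (use vanishes_from_diff[OF y(2) ax(2), of "real n" 1] y(3) n in auto)
  ultimately obtain c where c: "real n *\<^sub>R y - axis (\<sigma> m) 1 = (\<Sum>j<m. of_int (c j) *\<^sub>R hnf_vec \<sigma> a k j)"
    using H unfolding hnf_prefix_def hnf_lattice_def by blast
  define a' where "a' = a(m := n)"
  define k' where "k' = k(m := restrict (\<lambda>i. nat (c i mod int n)) {..<m})"
  note ext = hnf_vec_extend[OF n c, folded a'_def k'_def]
  have bm: "hnf_vec \<sigma> a' k' m \<in> M"
    unfolding ext(2) using H y(1) unfolding hnf_prefix_def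
    by (auto intro!: add_subgroup_diff[OF M] add_subgroup_sum[OF M] add_subgroup_of_int_scaleR[OF M])
  have "hnf_prefix \<sigma> M (Suc m) a' k'"
    unfolding hnf_prefix_def
  proof (intro conjI allI impI ballI)
    show "a' \<in> {..<Suc m} \<rightarrow>\<^sub>E {1..}"
      using H n unfolding hnf_prefix_def a'_def lessThan_Suc by (intro PiE_fun_upd) auto
    have "(\<Pi>\<^sub>E j\<in>{..<m}. {..<j} \<rightarrow>\<^sub>E {..<a' j}) = (\<Pi>\<^sub>E j\<in>{..<m}. {..<j} \<rightarrow>\<^sub>E {..<a j})"
      by (intro PiE_cong) (simp add: a'_def)
    then show "k' \<in> (\<Pi>\<^sub>E j\<in>{..<Suc m}. {..<j} \<rightarrow>\<^sub>E {..<a' j})"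
      using H n unfolding hnf_prefix_def k'_def lessThan_Suc
      by (intro PiE_fun_upd) (auto simp: a'_def nat_less_iff)
    show "hnf_vec \<sigma> a' k' j \<in> M" if "j < Suc m" for j
      using that bm H ext(1) unfolding hnf_prefix_def by (cases "j = m") auto
  next
    fix x assume x: "x \<in> M" "vanishes_from \<sigma> (Suc m) x"
    obtain z :: int where z: "x $ \<sigma> m = of_int z / real n" using pivot[OF x] by blast
    have diag: "hnf_vec \<sigma> a' k' m $ \<sigma> m = 1 / real n"
      using hnf_vec_diag[OF inj_\<sigma> m] by (simp add: a'_def)
    have "vanishes_from \<sigma> m (x - of_int z *\<^sub>R hnf_vec \<sigma> a' k' m)"
      by (rule vanishes_from_Suc)
        (use vanishes_from_diff[OF x(2) hnf_vec_vanishes_from[OF inj_\<sigma>], of 1 "of_int z" a' k'] z diag in auto)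
    moreover have "x - of_int z *\<^sub>R hnf_vec \<sigma> a' k' m \<in> M"
      using add_subgroup_diff[OF M x(1) add_subgroup_of_int_scaleR[OF M bm]] .
    ultimately have "x - of_int z *\<^sub>R hnf_vec \<sigma> a' k' m \<in> hnf_lattice \<sigma> a k m"
      using H unfolding hnf_prefix_def by blast
    then show "x \<in> hnf_lattice \<sigma> a' k' (Suc m)" by (rule hnf_lattice_Suc[OF _ ext(1)])
  qed
  then show thesis by (rule that)
qed

lemma hnf_prefix_exists: "m \<le> CARD('n) \<Longrightarrow> \<exists>a k. hnf_prefix \<sigma> M m a k"
proof (induction m)
  case 0
  then show ?case using hnf_prefix_0 by blast
next
  case (Suc m)
  then show ?case using hnf_prefix_Suc by (metis Suc_le_lessD Suc_leD)
qed

lemma hnf_representation: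
  assumes "card (vec_frac ` M) \<le> I"
  obtains a k where "(a, k) \<in> hnf_params CARD('n) I" "M = hnf_lattice \<sigma> a k CARD('n)"
proof -
  obtain a k where H: "hnf_prefix \<sigma> M CARD('n) a k" using hnf_prefix_exists by blast
  then have b: "hnf_vec \<sigma> a k j \<in> M" if "j < CARD('n)" for j
    using that by (simp add: hnf_prefix_def)
  have lattice: "M = hnf_lattice \<sigma> a k CARD('n)"
  proof
    show "M \<subseteq> hnf_lattice \<sigma> a k CARD('n)" using H by (auto simp: hnf_prefix_def vanishes_from_def)
    show "hnf_lattice \<sigma> a k CARD('n) \<subseteq> M"
    proof
      fix x assume "x \<in> hnf_lattice \<sigma> a k CARD('n)"
      then obtain t where "x = (\<Sum>j<CARD('n). of_int (t j) *\<^sub>R hnf_vec \<sigma> a k j)"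
        by (auto simp: hnf_lattice_def)
      also have "\<dots> \<in> M" using b by (intro add_subgroup_sum[OF M] add_subgroup_of_int_scaleR[OF M]) auto
      finally show "x \<in> M" .
    qed
  qed
  have "(\<lambda>t. vec_frac (\<Sum>j<CARD('n). real (t j) *\<^sub>R hnf_vec \<sigma> a k j)) ` (\<Pi>\<^sub>E j\<in>{..<CARD('n)}. {..<a j})
      \<subseteq> vec_frac ` M"
  proof (intro image_subsetI imageI)
    fix t :: "nat \<Rightarrow> nat"
    show "(\<Sum>j<CARD('n). real (t j) *\<^sub>R hnf_vec \<sigma> a k j) \<in> M"
      using add_subgroup_of_int_scaleR[OF M b, of _ "int (t _)"] by (intro add_subgroup_sum[OF M]) simp
  qed
  then have "card ((\<lambda>t. vec_frac (\<Sum>j<CARD('n). real (t j) *\<^sub>R hnf_vec \<sigma> a k j)) `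
      (\<Pi>\<^sub>E j\<in>{..<CARD('n)}. {..<a j})) \<le> card (vec_frac ` M)"
    by (rule card_mono[OF finite_frac])
  then have "card (\<Pi>\<^sub>E j\<in>{..<CARD('n)}. {..<a j}) \<le> card (vec_frac ` M)"
    by (simp only: card_image[OF inj_on_hnf_frac[OF inj_\<sigma>]])
  then have "prod a {..<CARD('n)} \<le> I" using assms by (simp add: card_PiE)
  then have "(a, k) \<in> hnf_params CARD('n) I" using H by (simp add: hnf_params_def hnf_prefix_def)
  then show thesis using that lattice by blast
qed

end

section \<open>Perfect lattices\<close>

definition sym_matrices :: "(real^'n^'n::finite) set" where
  "sym_matrices = {M. transpose M = M}"

lemma subspace_sym_matrices: "subspace sym_matrices"
  unfolding subspace_def sym_matrices_def by (simp add: transpose_def vec_eq_iff)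

lemma outer_sq_in_sym_matrices: "outer_sq u \<in> sym_matrices"
  by (simp add: sym_matrices_def outer_sq_def transpose_def vec_eq_iff mult.commute)

lemma inner_outer_sq: "inner (outer_sq u) (outer_sq v) = (u \<bullet> v)\<^sup>2"
proof -
  have "inner (outer_sq u) (outer_sq v) = (\<Sum>i\<in>UNIV. \<Sum>j\<in>UNIV. (u $ i * v $ i) * (u $ j * v $ j))"
    unfolding outer_sq_def inner_vec_def by (simp add: inner_real_def algebra_simps)
  also have "\<dots> = (\<Sum>i\<in>UNIV. u $ i * v $ i) * (\<Sum>j\<in>UNIV. u $ j * v $ j)" by (simp add: sum_product)
  finally show ?thesis by (simp add: inner_vec_def inner_real_def power2_eq_square)
qed

lemma inner_outer_sq_left: "inner (outer_sq u) G = u \<bullet> (G *v u)"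
  unfolding outer_sq_def inner_vec_def matrix_vector_mult_def
  by (simp add: inner_real_def sum_distrib_left algebra_simps)

lemma inner_transpose_mult_self:
  fixes T :: "real^'n^'n::finite"
  shows "u \<bullet> ((transpose T ** T) *v u) = (T *v u) \<bullet> (T *v u)"
proof -
  have "u \<bullet> ((transpose T ** T) *v u) = u \<bullet> (transpose T *v (T *v u))"
    by (simp add: matrix_vector_mul_assoc)
  also have "\<dots> = (\<Sum>i\<in>UNIV. \<Sum>r\<in>UNIV. u $ i * (T $ r $ i * (T *v u) $ r))"
    by (simp add: inner_vec_def inner_real_def matrix_vector_mult_def transpose_def sum_distrib_left)
  also have "\<dots> = (\<Sum>r\<in>UNIV. \<Sum>i\<in>UNIV. u $ i * (T $ r $ i * (T *v u) $ r))" by (rule sum.swap)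
  also have "\<dots> = (T *v u) \<bullet> (T *v u)"
    by (simp add: inner_vec_def inner_real_def matrix_vector_mult_def sum_distrib_right algebra_simps)
  finally show ?thesis .
qed

lemma outer_sq_eq_0_iff [simp]: "outer_sq u = 0 \<longleftrightarrow> u = 0"
proof
  assume "outer_sq u = 0"
  then have "(u \<bullet> u)\<^sup>2 = 0" using inner_outer_sq[of u u] by simp
  then show "u = 0" by simp
qed (simp add: outer_sq_def vec_eq_iff)

lemma perfect_imp_well_rounded:
  fixes L :: "(real^'n::finite) set"
  assumes "perfect L"
  shows "well_rounded L"
proof (rule ccontr)
  assume "\<not> well_rounded L"
  then have "dim (min_vecs L) < DIM(real^'n)"
    unfolding well_rounded_def by (metis dim_eq_full dim_subset_UNIV le_antisym not_less)
  then obtain u :: "real^'n" where u: "u \<noteq> 0" "\<And>y. y \<in> span (min_vecs L) \<Longrightarrow> orthogonal u y"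
    using orthogonal_to_subspace_exists by blast
  text \<open>Then \<open>u \<otimes> u\<close> is a symmetric matrix orthogonal to every \<open>v \<otimes> v\<close>, \<open>v\<close> minimal.\<close>
  have "outer_sq u \<in> span (outer_sq ` min_vecs L)"
    using assms outer_sq_in_sym_matrices unfolding perfect_def sym_matrices_def by auto
  moreover have "orthogonal (outer_sq u) (outer_sq v)" if "v \<in> min_vecs L" for v
    using u(2)[OF span_base[OF that]] by (simp add: orthogonal_def inner_outer_sq)
  ultimately have "orthogonal (outer_sq u) (outer_sq u)" using orthogonal_to_span by blast
  then show False using u(1) by (simp add: orthogonal_def)
qed

definition sym_unit :: "'n::finite set \<Rightarrow> real^'n^'n" where
  "sym_unit A = (\<chi> i j. if {i, j} = A then 1 else 0)"

definition index_pairs :: "'n::finite set set" where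
  "index_pairs = {A. card A = 1 \<or> card A = 2}"

lemma card_index_pairs: "card (index_pairs :: 'n::finite set set) = CARD('n) + (CARD('n) choose 2)"
proof -
  define X where "X = {A::'n set. A \<subseteq> UNIV \<and> card A = 1}"
  define Y where "Y = {A::'n set. A \<subseteq> UNIV \<and> card A = 2}"
  have "card X = CARD('n)" "card Y = CARD('n) choose 2"
    unfolding X_def Y_def using n_subsets[of "UNIV::'n set"] by simp_all
  moreover have "card (X \<union> Y) = card X + card Y" by (rule card_Un_disjoint) (auto simp: X_def Y_def)
  moreover have "index_pairs = X \<union> Y" unfolding index_pairs_def X_def Y_def by auto
  ultimately show ?thesis by simp
qed

lemma index_pairs_iff: "A \<in> index_pairs \<longleftrightarrow> (\<exists>i j. A = {i, j})"
proof
  assume "A \<in> index_pairs"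
  then have "card A = 1 \<or> card A = 2" by (simp add: index_pairs_def)
  then show "\<exists>i j. A = {i, j}"
  proof
    assume "card A = 1"
    then obtain i where "A = {i}" by (auto simp: card_1_singleton_iff)
    then show ?thesis by (intro exI[of _ i]) simp
  qed (auto simp: card_2_iff)
next
  assume "\<exists>i j. A = {i, j}"
  then obtain i j where "A = {i, j}" by blast
  then show "A \<in> index_pairs" by (cases "i = j") (auto simp: index_pairs_def)
qed

lemma doubleton_in_index_pairs: "{i, j} \<in> index_pairs"
  using index_pairs_iff by blast

lemma sym_unit_apply: "sym_unit {i, j} $ i $ j = 1"
  by (simp add: sym_unit_def)

lemma sym_matrices_subset_span_sym_unit:
  "sym_matrices \<subseteq> span (sym_unit ` (index_pairs :: 'n::finite set set))"
proof
  fix G :: "real^'n^'n" assume G: "G \<in> sym_matrices"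
  have sym: "G $ j $ i = G $ i $ j" for i j
  proof -
    have "transpose G $ i $ j = G $ j $ i" by (simp add: transpose_def)
    then show ?thesis using G by (simp add: sym_matrices_def)
  qed
  define c where "c A = G $ fst (SOME p. {fst p, snd p} = A) $ snd (SOME p. {fst p, snd p} = A)" for A
  have c: "c {i, j} = G $ i $ j" for i j
  proof -
    have "\<exists>p. {fst p, snd p} = {i, j}" by (intro exI[of _ "(i, j)"]) simp
    then have "{fst (SOME p. {fst p, snd p} = {i, j}), snd (SOME p. {fst p, snd p} = {i, j})} = {i, j}"
      by (rule someI_ex)
    then show ?thesis unfolding c_def using sym by (auto simp: doubleton_eq_iff)
  qed
  have "G $ i $ j = (\<Sum>A\<in>index_pairs. c A *\<^sub>R sym_unit A) $ i $ j" for i j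
  proof -
    have "(\<Sum>A\<in>index_pairs. c A *\<^sub>R sym_unit A) $ i $ j = (\<Sum>A\<in>index_pairs. if {i, j} = A then c A else 0)"
      by (simp add: sum_component sym_unit_def if_distrib cong: if_cong)
    also have "\<dots> = c {i, j}" by (simp add: sum.delta doubleton_in_index_pairs)
    finally show ?thesis by (simp add: c)
  qed
  then have "G = (\<Sum>A\<in>index_pairs. c A *\<^sub>R sym_unit A)" by (simp add: vec_eq_iff)
  also have "\<dots> \<in> span (sym_unit ` index_pairs)" by (intro span_sum span_scale span_base) auto
  finally show "G \<in> span (sym_unit ` index_pairs)" .
qed

lemma independent_sym_unit: "independent (sym_unit ` (index_pairs :: 'n::finite set set))"
proof (rule pairwise_orthogonal_independent)
  show "pairwise orthogonal (sym_unit ` (index_pairs :: 'n set set))"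
    unfolding pairwise_def orthogonal_def
    by (auto simp: sym_unit_def inner_vec_def inner_real_def intro!: sum.neutral)
  show "0 \<notin> sym_unit ` (index_pairs :: 'n set set)"
  proof
    assume "0 \<in> sym_unit ` (index_pairs :: 'n set set)"
    then obtain i j :: 'n where "sym_unit {i, j} = 0" by (auto simp: index_pairs_iff)
    then show False using sym_unit_apply[of i j] by simp
  qed
qed

lemma dim_sym_matrices: "dim (sym_matrices :: (real^'n^'n::finite) set) = CARD('n) + (CARD('n) choose 2)"
proof -
  have inj: "inj_on sym_unit (index_pairs :: 'n set set)"
  proof
    fix A B :: "'n set" assume "A \<in> index_pairs" "sym_unit A = sym_unit B"
    then obtain i j where "A = {i, j}" "sym_unit B $ i $ j = 1"
      using sym_unit_apply by (metis index_pairs_iff)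
    then show "A = B" by (simp add: sym_unit_def split: if_splits)
  qed
  have "sym_unit ` (index_pairs :: 'n set set) \<subseteq> sym_matrices"
    by (auto simp: sym_matrices_def sym_unit_def transpose_def vec_eq_iff insert_commute)
  then have "card (sym_unit ` (index_pairs :: 'n set set)) = dim (sym_matrices :: (real^'n^'n) set)"
    using basis_card_eq_dim[OF _ sym_matrices_subset_span_sym_unit independent_sym_unit] by blast
  then show ?thesis using card_image[OF inj] card_index_pairs[where 'n='n] by simp
qed

lemma independent_outer_sq_basis:
  fixes f :: "'n::finite \<Rightarrow> real^'n"
  assumes V: "invertible (column_matrix f)"
  shows "independent (outer_sq ` range f)" "card (outer_sq ` range f) = CARD('n)"
proof -
  text \<open>The rows of the inverse matrix form the dual basis; their squares are dual to the \<open>f i \<otimes> f i\<close>.\<close>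
  define u where "u j = matrix_inv (column_matrix f) $ j" for j
  have "u j \<bullet> f i = (matrix_inv (column_matrix f) ** column_matrix f) $ j $ i" for i j
    by (simp add: u_def matrix_matrix_mult_def column_matrix_def inner_vec_def inner_real_def mult.commute)
  then have dual: "inner (outer_sq (u j)) (outer_sq (f i)) = (if j = i then 1 else 0)" for i j
    by (simp add: inner_outer_sq matrix_inv_left[OF V] mat_def)
  have inj: "inj (\<lambda>i. outer_sq (f i))"
    by (rule injI) (metis dual zero_neq_one)
  then show "card (outer_sq ` range f) = CARD('n)" by (simp add: image_image card_image)
  show "independent (outer_sq ` range f)"
  proof (rule independent_if_scalars_zero)
    fix g X assume sum0: "(\<Sum>X\<in>outer_sq ` range f. g X *\<^sub>R X) = 0" and "X \<in> outer_sq ` range f"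
    then obtain i where X: "X = outer_sq (f i)" by auto
    have "0 = inner (outer_sq (u i)) (\<Sum>X\<in>outer_sq ` range f. g X *\<^sub>R X)" using sum0 by simp
    also have "\<dots> = (\<Sum>j\<in>UNIV. g (outer_sq (f j)) * inner (outer_sq (u i)) (outer_sq (f j)))"
      by (simp add: inner_sum_right image_image sum.reindex[OF inj])
    also have "\<dots> = g X" by (simp add: dual X if_distrib[of "(*) _"] cong: if_cong)
    finally show "g X = 0" by simp
  qed simp
qed

lemma perfect_spanning_completion:
  fixes L :: "(real^'n::finite) set" and f :: "'n \<Rightarrow> real^'n"
  assumes perf: "perfect L" and fin: "finite (min_vecs L)"
    and f: "\<And>i. f i \<in> min_vecs L" and V: "invertible (column_matrix f)"
  obtains X where "X \<subseteq> min_vecs L" "card X = CARD('n) choose 2"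
    "sym_matrices \<subseteq> span (outer_sq ` (range f \<union> X))"
proof -
  define K where "K = CARD('n) choose 2"
  define W where "W = outer_sq ` min_vecs L"
  have spW: "span W = sym_matrices" using perf unfolding perfect_def W_def sym_matrices_def by simp
  have "outer_sq ` range f \<subseteq> W" unfolding W_def using f by auto
  then obtain B where B: "outer_sq ` range f \<subseteq> B" "B \<subseteq> W" "independent B" "W \<subseteq> span B"
    using maximal_independent_subset_extend independent_outer_sq_basis(1)[OF V] by metis
  have BS: "B \<subseteq> sym_matrices" using B(2) spW span_superset by blast
  have "card B \<le> CARD('n) + K"
    using independent_card_le_dim[OF BS B(3)] dim_sym_matrices[where 'n='n] by (simp add: K_def)
  have finB: "finite B" using independent_bound_general[OF B(3)] by simp
  then have "card (B - outer_sq ` range f) \<le> K"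
    using B(1) independent_outer_sq_basis(2)[OF V] \<open>card B \<le> CARD('n) + K\<close>
    by (simp add: card_Diff_subset)
  moreover have "B - outer_sq ` range f \<subseteq> outer_sq ` min_vecs L" using B(2) unfolding W_def by blast
  then obtain X0 where X0: "X0 \<subseteq> min_vecs L" "inj_on outer_sq X0"
    "B - outer_sq ` range f = outer_sq ` X0"
    unfolding subset_image_inj by blast
  moreover have finX0: "finite X0" using X0(1) fin by (rule finite_subset)
  ultimately have cX0: "card X0 \<le> K" by (simp add: card_image)
  have span0: "sym_matrices \<subseteq> span (outer_sq ` (range f \<union> X0))"
  proof -
    have "outer_sq ` (range f \<union> X0) = B" using B(1) X0(3) by auto
    then show ?thesis using spW span_minimal[OF B(4) subspace_span] by simp
  qed
  have "CARD('n) + K \<le> card W"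
    using dim_le_card[of sym_matrices W] spW fin dim_sym_matrices[where 'n='n] unfolding W_def K_def by simp
  also have "card W \<le> card (min_vecs L)" unfolding W_def using fin by (rule card_image_le)
  finally have "K - card X0 \<le> card (min_vecs L - X0)"
    using X0(1) finX0 by (simp add: card_Diff_subset)
  then obtain Y where Y: "Y \<subseteq> min_vecs L - X0" "card Y = K - card X0" "finite Y"
    by (rule obtain_subset_with_card_n)
  have "card (X0 \<union> Y) = K" using Y cX0 finX0 by (subst card_Un_disjoint) auto
  moreover have "span (outer_sq ` (range f \<union> X0)) \<subseteq> span (outer_sq ` (range f \<union> (X0 \<union> Y)))"
    by (intro span_mono image_mono) auto
  ultimately show thesis using that[of "X0 \<union> Y"] X0(1) Y(1) span0 K_def by blast
qed

section \<open>Similarity\<close>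

lemma similar_lat_refl: "similar_lat L L"
  unfolding similar_lat_def
  by (rule exI[of _ 1], rule exI[of _ "\<lambda>x. x"]) simp

lemma similar_lat_sym:
  assumes "similar_lat L1 L2" shows "similar_lat L2 L1"
proof -
  obtain c f where cf: "c > 0" "orthogonal_transformation f" "L2 = (\<lambda>v. c *\<^sub>R f v) ` L1"
    using assms unfolding similar_lat_def by blast
  define g where "g = inv f"
  have g: "orthogonal_transformation g" unfolding g_def by (rule orthogonal_transformation_inv[OF cf(2)])
  have gf: "g (f v) = v" for v
    unfolding g_def using orthogonal_transformation_inj[OF cf(2)] by (simp add: inv_f_f)
  have "(\<lambda>v. (1/c) *\<^sub>R g v) ` L2 = L1"
    using cf(1) unfolding cf(3) image_image
    by (simp add: orthogonal_transformation_scaleR[OF g] gf)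
  then show ?thesis unfolding similar_lat_def using g cf(1) by (intro exI[of _ "1/c"] exI[of _ g]) auto
qed

lemma similar_lat_trans:
  assumes "similar_lat L1 L2" "similar_lat L2 L3" shows "similar_lat L1 L3"
proof -
  obtain c f where cf: "c > 0" "orthogonal_transformation f" "L2 = (\<lambda>v. c *\<^sub>R f v) ` L1"
    using assms(1) unfolding similar_lat_def by blast
  obtain c' f' where cf': "c' > 0" "orthogonal_transformation f'" "L3 = (\<lambda>v. c' *\<^sub>R f' v) ` L2"
    using assms(2) unfolding similar_lat_def by blast
  have "L3 = (\<lambda>v. (c' * c) *\<^sub>R (f' \<circ> f) v) ` L1"
    unfolding cf' cf by (simp add: image_image orthogonal_transformation_scaleR[OF cf'(2)])
  then show ?thesis
    unfolding similar_lat_def using cf cf' orthogonal_transformation_compose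
    by (intro exI[of _ "c' * c"] exI[of _ "f' \<circ> f"]) auto
qed

lemma equiv_similarity_rel: "equiv UNIV similarity_rel"
  unfolding equiv_def refl_on_def sym_def trans_def similarity_rel_def
  using similar_lat_refl similar_lat_sym similar_lat_trans by blast

lemma scaleR_mat_1_mult: "((k::real) *\<^sub>R mat 1) *v (v::real^'n::finite) = k *\<^sub>R v"
  by (metis scaleR_matrix_vector_assoc matrix_vector_mul_lid)

text \<open>The symmetric matrix \<open>T\<^sup>T T - (l\<^sub>2/l\<^sub>1)\<^sup>2 I\<close> is orthogonal to all the squares \<open>v \<otimes> v\<close>,
  \<open>v \<in> S\<close>, hence zero.\<close>
lemma similarity_if_norms_on_spanning_squares:
  fixes T :: "real^'n^'n::finite"
  assumes span: "sym_matrices \<subseteq> span (outer_sq ` S)"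
    and l1: "l1 > 0" "\<And>v. v \<in> S \<Longrightarrow> norm v = l1"
    and l2: "l2 > 0" "\<And>v. v \<in> S \<Longrightarrow> norm (T *v v) = l2"
  obtains h where "orthogonal_transformation h" "\<And>v. T *v v = (l2 / l1) *\<^sub>R h v"
proof -
  define c where "c = l2 / l1"
  have c: "c > 0" using l1 l2 by (simp add: c_def)
  define G where "G = transpose T ** T - c\<^sup>2 *\<^sub>R mat 1"
  have "transpose T ** T \<in> sym_matrices" "c\<^sup>2 *\<^sub>R mat 1 \<in> sym_matrices"
    by (simp_all add: sym_matrices_def matrix_transpose_mul transpose_scalar)
  then have "G \<in> span (outer_sq ` S)" unfolding G_def using span subspace_diff[OF subspace_sym_matrices] by blast
  moreover have "orthogonal G y" if y: "y \<in> outer_sq ` S" for y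
  proof -
    obtain v where v: "v \<in> S" "y = outer_sq v" using y by blast
    have "inner (outer_sq v) G = (norm (T *v v))\<^sup>2 - c\<^sup>2 * (norm v)\<^sup>2"
      by (simp add: G_def inner_diff_right inner_outer_sq_left inner_transpose_mult_self
          power2_norm_eq_inner scaleR_mat_1_mult)
    also have "\<dots> = 0" using l1 l2 v(1) by (simp add: c_def power_divide)
    finally show ?thesis by (simp add: v(2) orthogonal_def inner_commute)
  qed
  ultimately have "orthogonal G G" by (rule orthogonal_to_span)
  then have TT: "transpose T ** T = c\<^sup>2 *\<^sub>R mat 1" by (simp add: orthogonal_def G_def)
  have norm_T: "norm (T *v v) = c * norm v" for v
  proof -
    have "(norm (T *v v))\<^sup>2 = v \<bullet> ((transpose T ** T) *v v)"
      by (simp add: inner_transpose_mult_self power2_norm_eq_inner)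
    also have "\<dots> = (c * norm v)\<^sup>2"
      unfolding TT by (simp add: scaleR_mat_1_mult power2_norm_eq_inner power_mult_distrib)
    finally show ?thesis using c by (simp add: power2_eq_iff_nonneg)
  qed
  define h where "h v = (1 / c) *\<^sub>R (T *v v)" for v
  have "orthogonal_transformation h"
    unfolding orthogonal_transformation h_def using c
    by (simp add: linear_iff matrix_vector_right_distrib matrix_vector_mult_scaleR algebra_simps norm_T)
  moreover have "T *v v = (l2 / l1) *\<^sub>R h v" for v
    unfolding h_def c_def[symmetric] using c by simp
  ultimately show thesis by (rule that)
qed

section \<open>Counting perfect lattices\<close>

lemma card_quotient_le:
  assumes r: "equiv UNIV r" and D: "finite D"
    and ex: "\<And>x. x \<in> A \<Longrightarrow> \<exists>\<delta>\<in>D. P x \<delta>"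
    and rel: "\<And>x y \<delta>. x \<in> A \<Longrightarrow> y \<in> A \<Longrightarrow> P x \<delta> \<Longrightarrow> P y \<delta> \<Longrightarrow> (x, y) \<in> r"
  shows "finite (A // r) \<and> card (A // r) \<le> card D"
proof -
  define rep where "rep \<delta> = (SOME x. x \<in> A \<and> P x \<delta>)" for \<delta>
  have "A // r \<subseteq> (\<lambda>\<delta>. r `` {rep \<delta>}) ` D"
  proof
    fix X assume "X \<in> A // r"
    then obtain x where x: "x \<in> A" "X = r `` {x}" by (auto elim: quotientE)
    then obtain \<delta> where \<delta>: "\<delta> \<in> D" "P x \<delta>" using ex by blast
    then have "rep \<delta> \<in> A \<and> P (rep \<delta>) \<delta>" using x(1) unfolding rep_def by (rule_tac someI) blast
    then have "r `` {x} = r `` {rep \<delta>}" using rel[OF x(1)] \<delta>(2) equiv_class_eq[OF r] by blast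
    then show "X \<in> (\<lambda>\<delta>. r `` {rep \<delta>}) ` D" using x(2) \<delta>(1) by blast
  qed
  then show ?thesis using D by (meson card_image_le finite_imageI finite_subset order_trans card_mono)
qed

definition unit_box_points :: "(real^'n::finite) set \<Rightarrow> (real^'n) set" where
  "unit_box_points M = {c \<in> M. \<forall>i. \<bar>c $ i\<bar> \<le> 1}"

lemma card_unit_box_points:
  fixes M :: "(real^'n::finite) set"
  assumes fin: "finite (vec_frac ` M)"
  shows "finite (unit_box_points M) \<and> card (unit_box_points M) \<le> card (vec_frac ` M) * 3 ^ CARD('n)"
proof -
  define h where "h c = (vec_frac c, \<lambda>i. \<lfloor>c $ i\<rfloor>)" for c :: "real^'n"
  define C where "C = vec_frac ` M \<times> ((UNIV :: 'n set) \<rightarrow>\<^sub>E {-1..1::int})"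
  have "h ` unit_box_points M \<subseteq> C"
  proof
    fix p assume "p \<in> h ` unit_box_points M"
    then obtain c where c: "c \<in> M" "\<And>i. \<bar>c $ i\<bar> \<le> 1" "p = h c" unfolding unit_box_points_def by auto
    have "\<lfloor>c $ i\<rfloor> \<in> {-1..1}" for i
      using c(2)[of i] by (auto simp: le_floor_iff floor_le_iff abs_le_iff)
    then show "p \<in> C" using c unfolding C_def h_def PiE_UNIV_domain by auto
  qed
  moreover have "inj_on h (unit_box_points M)"
  proof
    fix x y assume "h x = h y"
    then have "vec_frac x = vec_frac y" "vec_floor x = vec_floor y"
      by (auto simp: h_def vec_floor_def fun_eq_iff)
    then show "x = y" unfolding vec_frac_def by (metis diff_add_cancel)
  qed
  moreover have "finite C" "card C = card (vec_frac ` M) * 3 ^ CARD('n)"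
    using fin by (simp_all add: C_def finite_PiE card_cartesian_product card_PiE)
  ultimately show ?thesis
    by (metis card_image card_mono finite_imageD finite_subset)
qed

text \<open>By Cramer's rule, the \<open>k\<close>-th coordinate of \<open>w\<close> is the determinant of \<open>f\<close> with its \<open>k\<close>-th
  vector replaced by \<open>w\<close>, divided by the determinant of \<open>f\<close>; maximality bounds it by \<open>1\<close>.\<close>
lemma max_det_basis:
  fixes S :: "(real^'n::finite) set"
  assumes fin: "finite S" and span: "span S = UNIV"
  obtains f where "\<And>i. f i \<in> S" "invertible (column_matrix f)"
    "\<And>w k. w \<in> S \<Longrightarrow> \<bar>(matrix_inv (column_matrix f) *v w) $ k\<bar> \<le> 1"
proof -
  define F where "F = (UNIV :: 'n set) \<rightarrow>\<^sub>E S"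
  have finF: "finite F" unfolding F_def using fin by (simp add: finite_PiE)
  obtain g where g: "\<And>i. g i \<in> S" "invertible (column_matrix g)"
    using spanning_set_contains_basis[OF span] by metis
  then have "g \<in> F" by (simp add: F_def PiE_UNIV_domain)
  define D where "D = (\<lambda>f. \<bar>det (column_matrix f)\<bar>) ` F"
  have "Max D \<in> D" unfolding D_def using finF \<open>g \<in> F\<close> by (intro Max_in) auto
  then obtain f where f: "f \<in> F" "\<bar>det (column_matrix f)\<bar> = Max D" unfolding D_def by auto
  have maximal: "\<bar>det (column_matrix f')\<bar> \<le> \<bar>det (column_matrix f)\<bar>" if "f' \<in> F" for f'
    unfolding f(2) D_def using finF that by simp
  have "det (column_matrix f) \<noteq> 0"
    using maximal[OF \<open>g \<in> F\<close>] g(2) invertible_det_nz by fastforce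
  then have V: "invertible (column_matrix f)" by (simp add: invertible_det_nz)
  show thesis
  proof (rule that)
    show "f i \<in> S" for i using f(1) by (simp add: F_def PiE_UNIV_domain Pi_iff)
    show "invertible (column_matrix f)" by (rule V)
    fix w k assume w: "w \<in> S"
    define c where "c = matrix_inv (column_matrix f) *v w"
    have "column_matrix (f(k := w)) = (\<chi> i j. if j = k then (column_matrix f *v c) $ i else column_matrix f $ i $ j)"
      using V by (simp add: c_def matrix_inv_vector_right column_matrix_def vec_eq_iff)
    then have "det (column_matrix (f(k := w))) = c $ k * det (column_matrix f)"
      by (simp add: cramer_lemma)
    moreover have "f(k := w) \<in> F" using f(1) w by (simp add: F_def PiE_UNIV_domain Pi_iff)
    ultimately have "\<bar>c $ k\<bar> * \<bar>det (column_matrix f)\<bar> \<le> 1 * \<bar>det (column_matrix f)\<bar>"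
      using maximal by (metis abs_mult mult_1)
    then show "\<bar>c $ k\<bar> \<le> 1" using \<open>det (column_matrix f) \<noteq> 0\<close> by (simp add: mult_le_cancel_right)
  qed
qed

lemma sublattice_of_minimal_basis:
  fixes f :: "'n::finite \<Rightarrow> real^'n"
  defines "L' \<equiv> lattice_of (column_matrix f)"
  assumes L: "is_lattice L" and f: "\<And>i. f i \<in> min_vecs L" and V: "invertible (column_matrix f)"
  shows "is_lattice L'" "L' \<subseteq> L" "well_rounded L'" "min_vecs L' \<subseteq> min_vecs L"
proof -
  show "is_lattice L'" unfolding L'_def is_lattice_iff using V by blast
  have fL: "f i \<in> L" for i using f by (simp add: min_vecs_def)
  show sub: "L' \<subseteq> L" unfolding L'_def
    using L fL by (intro lattice_of_column_matrix_subset V) (auto simp: is_lattice_iff add_subgroup_lattice_of)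
  have fL': "f i \<in> L'" for i
    using mult_in_lattice_of_iff[OF V, of "axis i 1"] int_vec_axis by (simp add: L'_def column_matrix_axis)
  have fmin': "f i \<in> min_vecs L'" for i
    using f fL' sub by (auto simp: min_vecs_def)
  show "min_vecs L' \<subseteq> min_vecs L"
  proof
    fix v assume v: "v \<in> min_vecs L'"
    have "norm v \<le> norm (f i)" for i using v fL' f by (auto simp: min_vecs_def)
    then have "norm v \<le> norm w" if "w \<in> L" "w \<noteq> 0" for w
      using min_vecs_le[OF f that] order_trans by blast
    moreover have "v \<in> L" "v \<noteq> 0" using v sub by (auto simp: min_vecs_def)
    ultimately show "v \<in> min_vecs L" by (simp add: min_vecs_def)
  qed
  have "x \<in> span (range f)" for x
  proof -
    have "x = (\<Sum>i\<in>UNIV. (matrix_inv (column_matrix f) *v x) $ i *\<^sub>R f i)"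
      using V by (simp add: matrix_inv_vector_right flip: column_matrix_mult)
    also have "\<dots> \<in> span (range f)" by (intro span_sum span_scale span_base) auto
    finally show ?thesis .
  qed
  then show "well_rounded L'"
    unfolding well_rounded_def using span_mono[of "range f" "min_vecs L'"] fmin' by auto
qed

lemma coordinates_overlattice:
  fixes V :: "real^'n^'n::finite" and L :: "(real^'n) set"
  defines "M \<equiv> {c. V *v c \<in> L}"
  assumes L: "is_lattice L" and V: "invertible V" and sub: "lattice_of V \<subseteq> L"
    and fin: "finite ((\<lambda>v. {w \<in> L. w - v \<in> lattice_of V}) ` L)"
  shows "add_subgroup M" "\<And>x. int_vec x \<Longrightarrow> x \<in> M"
    "finite (vec_frac ` M)" "card (vec_frac ` M) \<le> lat_index L (lattice_of V)"
proof -
  have L_group: "add_subgroup L" using L by (auto simp: is_lattice_iff add_subgroup_lattice_of)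
  have "M = (*v) V -` L" by (auto simp: M_def)
  then show "add_subgroup M"
    using add_subgroup_vimage_linear[OF L_group matrix_vector_mul_linear] by simp
  show "int_vec x \<Longrightarrow> x \<in> M" for x
    using mult_in_lattice_of_iff[OF V] sub unfolding M_def by blast
  have "M = (*v) (matrix_inv V) ` L"
  proof (intro set_eqI iffI)
    fix c assume "c \<in> M"
    then show "c \<in> (*v) (matrix_inv V) ` L"
      using V by (intro image_eqI[of _ _ "V *v c"]) (simp_all add: M_def matrix_inv_vector_left)
  qed (use V in \<open>auto simp: M_def matrix_inv_vector_right\<close>)
  then have image: "vec_frac ` M = (\<lambda>x. vec_frac (matrix_inv V *v x)) ` L" by (simp add: image_image)
  have factor: "vec_frac (matrix_inv V *v x) = vec_frac (matrix_inv V *v y)"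
    if "x \<in> L" "y \<in> L" "{w \<in> L. w - x \<in> lattice_of V} = {w \<in> L. w - y \<in> lattice_of V}" for x y
    using that coset_eq_iff[OF add_subgroup_lattice_of sub that(1,2)]
    by (simp add: vec_frac_eq_iff lattice_of_def matrix_vector_mult_diff_distrib)
  show "finite (vec_frac ` M)" "card (vec_frac ` M) \<le> lat_index L (lattice_of V)"
    using card_image_le_if_factors[of L "\<lambda>v. {w \<in> L. w - v \<in> lattice_of V}", OF factor fin]
    unfolding lat_index_def image by simp_all
qed

text \<open>The data recorded for a perfect lattice \<open>L\<close>: in the coordinates of a basis \<open>f\<close> of minimal vectors,
  the Hermite normal form \<open>(a, k)\<close> of \<open>L\<close> and the coordinates \<open>S\<close> of further minimal vectors
  completing the squares of the basis to a spanning set of the symmetric matrices.\<close>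
fun lattice_data :: "(nat \<Rightarrow> 'n::finite) \<Rightarrow> (real^'n) set \<Rightarrow>
    ((nat \<Rightarrow> nat) \<times> (nat \<Rightarrow> nat \<Rightarrow> nat)) \<times> (real^'n) set \<Rightarrow> bool" where
  "lattice_data \<sigma> L ((a, k), S) \<longleftrightarrow> (\<exists>f X. (\<forall>i. f i \<in> min_vecs L) \<and> invertible (column_matrix f) \<and>
     {c. column_matrix f *v c \<in> L} = hnf_lattice \<sigma> a k CARD('n) \<and>
     X \<subseteq> min_vecs L \<and> sym_matrices \<subseteq> span (outer_sq ` (range f \<union> X)) \<and>
     S = (*v) (matrix_inv (column_matrix f)) ` X)"

definition data_space :: "(nat \<Rightarrow> 'n::finite) \<Rightarrow> nat \<Rightarrow>
    (((nat \<Rightarrow> nat) \<times> (nat \<Rightarrow> nat \<Rightarrow> nat)) \<times> (real^'n) set) set" where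
  "data_space \<sigma> I = Sigma
     {(a, k) \<in> hnf_params CARD('n) I. finite (vec_frac ` hnf_lattice \<sigma> a k CARD('n)) \<and>
        card (vec_frac ` hnf_lattice \<sigma> a k CARD('n)) \<le> I}
     (\<lambda>(a, k). {S. S \<subseteq> unit_box_points (hnf_lattice \<sigma> a k CARD('n)) \<and> card S = CARD('n) choose 2})"

lemma finite_card_data_space:
  fixes \<sigma> :: "nat \<Rightarrow> 'n::finite"
  shows "finite (data_space \<sigma> I) \<and>
    card (data_space \<sigma> I) \<le> I ^ CARD('n) * ((3 ^ CARD('n) * I) choose (CARD('n) choose 2))"
proof -
  define A where "A = {(a, k) \<in> hnf_params CARD('n) I. finite (vec_frac ` hnf_lattice \<sigma> a k CARD('n)) \<and>
    card (vec_frac ` hnf_lattice \<sigma> a k CARD('n)) \<le> I}"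
  define C where "C = (3 ^ CARD('n) * I) choose (CARD('n) choose 2)"
  have A_sub: "A \<subseteq> hnf_params CARD('n) I" unfolding A_def by blast
  then have A: "finite A" "card A \<le> I ^ CARD('n)"
    using card_hnf_params[of "CARD('n)" I] finite_subset card_mono le_trans by metis+
  have fibre: "finite {S. S \<subseteq> unit_box_points (hnf_lattice \<sigma> a k CARD('n)) \<and> card S = CARD('n) choose 2} \<and>
      card {S. S \<subseteq> unit_box_points (hnf_lattice \<sigma> a k CARD('n)) \<and> card S = CARD('n) choose 2} \<le> C"
    if "(a, k) \<in> A" for a k
  proof -
    define U where "U = unit_box_points (hnf_lattice \<sigma> a k CARD('n))"
    have "finite (vec_frac ` hnf_lattice \<sigma> a k CARD('n))" "card (vec_frac ` hnf_lattice \<sigma> a k CARD('n)) \<le> I"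
      using that by (simp_all add: A_def)
    then have "finite U" "card U \<le> I * 3 ^ CARD('n)"
      using card_unit_box_points[of "hnf_lattice \<sigma> a k CARD('n)"] mult_le_mono1 le_trans
      unfolding U_def by blast+
    then show ?thesis
      unfolding U_def[symmetric] C_def using n_subsets[of U] binomial_right_mono[of "card U"]
      by (simp add: finite_subset[of _ "Pow U"] subset_eq mult.commute)
  qed
  define Sig where "Sig = Sigma A (\<lambda>(a, k).
    {S. S \<subseteq> unit_box_points (hnf_lattice \<sigma> a k CARD('n)) \<and> card S = CARD('n) choose 2})"
  have "data_space \<sigma> I = Sig" unfolding data_space_def A_def Sig_def ..
  moreover have "finite Sig" unfolding Sig_def using A(1) fibre by (intro finite_SigmaI) auto
  moreover have "card Sig \<le> card A * C"
    unfolding Sig_def using A(1) fibre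
    by (subst card_SigmaI) (auto intro: sum_bounded_above[where K = C, simplified])
  ultimately show ?thesis using order_trans[OF _ mult_le_mono1[OF A(2)]] unfolding C_def by simp
qed

lemma perfect_lattice_data:
  fixes L :: "(real^'n::finite) set" and \<sigma> :: "nat \<Rightarrow> 'n"
  assumes \<sigma>: "bij_betw \<sigma> {..<CARD('n)} UNIV" and L: "is_lattice L" and perf: "perfect L"
  shows "\<exists>\<delta>\<in>data_space \<sigma> (I_const TYPE('n)). lattice_data \<sigma> L \<delta>"
proof -
  define I where "I = I_const TYPE('n)"
  have fin: "finite (min_vecs L)" using L finite_min_vecs_lattice_of by (auto simp: is_lattice_iff)
  obtain f where f: "\<And>i. f i \<in> min_vecs L" "invertible (column_matrix f)"
    and box: "\<And>w k. w \<in> min_vecs L \<Longrightarrow> \<bar>(matrix_inv (column_matrix f) *v w) $ k\<bar> \<le> 1"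
    using max_det_basis[OF fin] perfect_imp_well_rounded[OF perf] unfolding well_rounded_def by metis
  define V where "V = column_matrix f"
  define M where "M = {c. V *v c \<in> L}"
  note L' = sublattice_of_minimal_basis[OF L f, folded V_def]
  have index: "finite ((\<lambda>v. {w \<in> L. w - v \<in> lattice_of V}) ` L)" "lat_index L (lattice_of V) \<le> I"
    using lat_index_le_power[OF L L'] lat_index_le_I_const[OF L L'] by (simp_all add: I_def)
  note coords = coordinates_overlattice[OF L f(2)[folded V_def] L'(2) index(1), folded M_def]
  interpret overlattice \<sigma> M
    using \<sigma> coords by unfold_locales auto
  have "card (vec_frac ` M) \<le> I" using coords(4) index(2) by simp
  then obtain a k where ak: "(a, k) \<in> hnf_params CARD('n) I" "M = hnf_lattice \<sigma> a k CARD('n)"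
    by (rule hnf_representation)
  obtain X where X: "X \<subseteq> min_vecs L" "card X = CARD('n) choose 2"
    "sym_matrices \<subseteq> span (outer_sq ` (range f \<union> X))"
    using perfect_spanning_completion[OF perf fin f] by blast
  define S where "S = (*v) (matrix_inv V) ` X"
  have "S \<subseteq> unit_box_points M"
  proof
    fix c assume "c \<in> S"
    then obtain x where x: "x \<in> X" "c = matrix_inv V *v x" unfolding S_def by blast
    then have "V *v c \<in> L" using X(1) f(2) by (auto simp: V_def matrix_inv_vector_right min_vecs_def)
    then show "c \<in> unit_box_points M" using box x X(1) by (auto simp: unit_box_points_def M_def V_def)
  qed
  moreover have "card S = CARD('n) choose 2"
    unfolding S_def using X(2) inj_matrix_inv_vector[OF f(2)] by (simp add: V_def card_image inj_on_subset)
  ultimately have "((a, k), S) \<in> data_space \<sigma> I"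
    using ak coords(3) \<open>card (vec_frac ` M) \<le> I\<close> by (simp add: data_space_def)
  moreover have "lattice_data \<sigma> L ((a, k), S)"
    using f X ak(2) by (auto simp: S_def M_def V_def)
  ultimately show ?thesis unfolding I_def by blast
qed

lemma lattice_eq_image_if_same_coordinates:
  fixes V1 V2 :: "real^'n^'n::finite"
  assumes V: "invertible V1" "invertible V2" and M: "{c. V1 *v c \<in> L1} = {c. V2 *v c \<in> L2}"
  shows "L2 = (\<lambda>v. (V2 ** matrix_inv V1) *v v) ` L1"
proof -
  have iff: "V1 *v c \<in> L1 \<longleftrightarrow> V2 *v c \<in> L2" for c using M by blast
  have "V2 *v (matrix_inv V1 *v x) \<in> L2 \<longleftrightarrow> x \<in> L1" for x
    using iff[of "matrix_inv V1 *v x"] V by (simp add: matrix_inv_vector_right)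
  moreover have "V2 *v (matrix_inv V1 *v (V1 *v (matrix_inv V2 *v y))) = y" for y
    using V by (simp add: matrix_inv_vector_left matrix_inv_vector_right)
  ultimately show ?thesis
    by (auto simp: matrix_vector_mul_assoc[symmetric] image_iff) metis
qed

lemma lattice_data_similar:
  fixes L1 L2 :: "(real^'n::finite) set" and \<delta> :: "((nat \<Rightarrow> nat) \<times> (nat \<Rightarrow> nat \<Rightarrow> nat)) \<times> (real^'n) set"
  assumes "lattice_data \<sigma> L1 \<delta>" "lattice_data \<sigma> L2 \<delta>"
  shows "similar_lat L1 L2"
proof -
  obtain a k S where \<delta>: "\<delta> = ((a, k), S)" by (metis prod.exhaust)
  obtain f1 X1 where f1: "\<And>i. f1 i \<in> min_vecs L1" "invertible (column_matrix f1)"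
    "{c. column_matrix f1 *v c \<in> L1} = hnf_lattice \<sigma> a k CARD('n)"
    "X1 \<subseteq> min_vecs L1" "sym_matrices \<subseteq> span (outer_sq ` (range f1 \<union> X1))"
    "S = (*v) (matrix_inv (column_matrix f1)) ` X1"
    using assms(1) unfolding \<delta> by auto
  obtain f2 X2 where f2: "\<And>i. f2 i \<in> min_vecs L2" "invertible (column_matrix f2)"
    "{c. column_matrix f2 *v c \<in> L2} = hnf_lattice \<sigma> a k CARD('n)"
    "X2 \<subseteq> min_vecs L2" "S = (*v) (matrix_inv (column_matrix f2)) ` X2"
    using assms(2) unfolding \<delta> by auto
  define T where "T = column_matrix f2 ** matrix_inv (column_matrix f1)"
  have L2: "L2 = (\<lambda>v. T *v v) ` L1"
    unfolding T_def using f1(2,3) f2(2,3) by (intro lattice_eq_image_if_same_coordinates) auto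
  have maps_min: "T *v v \<in> min_vecs L2" if "v \<in> range f1 \<union> X1" for v
  proof (cases "v \<in> range f1")
    case True
    then obtain i where "v = f1 i" by blast
    then show ?thesis using f1(2) f2(1)
      by (simp add: T_def matrix_vector_mul_assoc[symmetric] matrix_inv_column_matrix_apply column_matrix_axis)
  next
    case False
    then have "matrix_inv (column_matrix f1) *v v \<in> S" using that f1(6) by blast
    then obtain x2 where "x2 \<in> X2" "matrix_inv (column_matrix f1) *v v = matrix_inv (column_matrix f2) *v x2"
      using f2(5) by blast
    then show ?thesis using f2(2,4)
      by (auto simp: T_def matrix_vector_mul_assoc[symmetric] matrix_inv_vector_right)
  qed
  define l1 where "l1 = norm (f1 undefined)"
  define l2 where "l2 = norm (f2 undefined)"
  have "norm (T *v v) = l2" if "v \<in> range f1 \<union> X1" for v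
    using maps_min[OF that] f2(1) min_vecs_norm_eq
    unfolding l2_def by blast
  moreover have "norm v = l1" if "v \<in> range f1 \<union> X1" for v
    using that f1(1,4) min_vecs_norm_eq unfolding l1_def by blast
  moreover have "l1 > 0" "l2 > 0"
    using f1(1) f2(1) by (auto simp: l1_def l2_def min_vecs_def)
  ultimately obtain h where h: "orthogonal_transformation h" "\<And>v. T *v v = (l2 / l1) *\<^sub>R h v"
    using similarity_if_norms_on_spanning_squares[OF f1(5)] by metis
  show ?thesis
    unfolding similar_lat_def L2 h(2) using h(1) \<open>l1 > 0\<close> \<open>l2 > 0\<close> by (intro exI conjI) auto
qed

theorem theorem10p1:
  assumes "CARD('n::finite) \<ge> 2"
  shows "finite ({L :: (real^'n) set. is_lattice L \<and> perfect L} // similarity_rel) \<and>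
    card ({L :: (real^'n) set. is_lattice L \<and> perfect L} // similarity_rel)
      \<le> I_const TYPE('n) ^ (CARD('n) + 1)
         * ((3 ^ CARD('n) * I_const TYPE('n)) choose (CARD('n) choose 2))"
proof -
  define I where "I = I_const TYPE('n)"
  define C where "C = (3 ^ CARD('n) * I) choose (CARD('n) choose 2)"
  obtain \<sigma> :: "nat \<Rightarrow> 'n" where \<sigma>: "bij_betw \<sigma> {..<CARD('n)} UNIV"
    using ex_bij_betw_nat_finite[of "UNIV :: 'n set"] by (auto simp: atLeast0LessThan)
  have "finite ({L :: (real^'n) set. is_lattice L \<and> perfect L} // similarity_rel) \<and>
      card ({L :: (real^'n) set. is_lattice L \<and> perfect L} // similarity_rel) \<le> card (data_space \<sigma> I)"
  proof (rule card_quotient_le[OF equiv_similarity_rel, where P = "lattice_data \<sigma>"])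
    show "finite (data_space \<sigma> I)" using finite_card_data_space by blast
    show "\<exists>\<delta>\<in>data_space \<sigma> I. lattice_data \<sigma> L \<delta>" if "L \<in> {L. is_lattice L \<and> perfect L}" for L
      using perfect_lattice_data[OF \<sigma>] that unfolding I_def by blast
    show "(L1, L2) \<in> similarity_rel" if "lattice_data \<sigma> L1 \<delta>" "lattice_data \<sigma> L2 \<delta>" for L1 L2 \<delta>
      using lattice_data_similar[OF that] by (simp add: similarity_rel_def)
  qed
  moreover have "card (data_space \<sigma> I) \<le> I ^ CARD('n) * C"
    using finite_card_data_space[of \<sigma> I] by (simp add: C_def)
  moreover have "I ^ CARD('n) * C \<le> I ^ (CARD('n) + 1) * C"
    by (cases "I = 0") (simp_all add: power_increasing)
  ultimately show ?thesis unfolding I_def C_def by linarith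
qed

end
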